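(* Let $(M,\nabla)$ be an affine surface with local coordinates $(x^1,x^2)$ in which the type $(1,1)$ tensor field $T=T^r{}_i\,\partial_{x^r}\otimes dx^i$ has the form $$T=\begin{pmatrix} T^1{}_1 & T^1{}_2 \\ T^2{}_1 & T^2{}_2 \end{pmatrix}=\alpha(x^1,x^2)\begin{pmatrix} \xi(x^1,x^2) & 1 \\ -\xi^2(x^1,x^2) & -\xi(x^1,x^2) \end{pmatrix}$$ for smooth functions $\alpha,\xi$ with $\alpha$ nowhere zero, and let $\Phi$ be an arbitrary smooth symmetric $2$-tensor on $M$. Then the modified Riemannian extension $(T^*M,g_{T,\nabla,\Phi})$ is Bach flat if and only if $\alpha$ and $\xi$ are solutions to the partial differential equations $\mathcal{P}_1(\xi)=0$ and $\mathcal{P}_2(\xi,\alpha)=0$, where $\mathcal{P}_1$ and $\mathcal{P}_2$ are the differential operators, depending on the Christoffel symbols of $\nabla$, written out in the context.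
   Context: An affine surface $(M,\nabla)$ is a smooth $2$-dimensional manifold $M$ with a torsion-free connection $\nabla$ on $TM$; in local coordinates $(x^1,x^2)$, $\nabla_{\partial_{x^i}}\partial_{x^j}=\Gamma_{ij}{}^k\partial_{x^k}$ (repeated indices are summed). Let $(y_1,y_2)$ be the dual fiber coordinates on $T^*M$, where a $1$-form is written $\omega=y_1dx^1+y_2dx^2$. The modified Riemannian extension is the neutral signature $(2,2)$ metric on $T^*M$ $$g_{T,\nabla,\Phi}=2\,dx^i\circ dy_i+\left\{\tfrac12 y_ry_s(T^r{}_iT^s{}_j+T^r{}_jT^s{}_i)-2y_k\Gamma_{ij}{}^k+\Phi_{ij}\right\}dx^i\circ dx^j,$$ where $\circ$ is the symmetric product (so $g(\partial_{x^i},\partial_{y_j})=\delta_{ij}$, $g(\partial_{y_i},\partial_{y_j})=0$, and $g(\partial_{x^i},\partial_{x^j})$ is the expression in braces). For a four-dimensional pseudo-Riemannian manifold $(N,g)$ with Levi-Civita connection ${}^g\nabla$, curvature operator $R(X,Y)={}^g\nabla_X{}^g\nabla_Y-{}^g\nabla_Y{}^g\nabla_X-{}^g\nabla_{[X,Y]}$, Weyl tensor $W$ and Ricci tensor $\rho$, the Bach tensor is $\mathfrak{B}_{ij}={}^g\nabla^k\,{}^g\nabla^\ell W_{kij\ell}+\tfrac12\rho^{k\ell}W_{kij\ell}$; $(N,g)$ is Bach flat if $\mathfrak{B}=0$. For a function $\phi(x^1,x^2)$ write $\phi^{(a,b)}=\partial_{x^1}^a\partial_{x^2}^b\phi$. The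 operators are $$\mathcal{P}_1(\xi):=-\xi^{(1,0)}+\xi\,\xi^{(0,1)}+\Gamma_{22}{}^1\xi^3-(2\Gamma_{12}{}^1-\Gamma_{22}{}^2)\xi^2+(\Gamma_{11}{}^1-2\Gamma_{12}{}^2)\xi+\Gamma_{11}{}^2,$$ $$\begin{aligned} \mathcal{P}_2(\xi,\alpha):=\ &\alpha\alpha^{(2,0)}+\xi^2\alpha\alpha^{(0,2)}-2\xi\alpha\alpha^{(1,1)}+(\alpha^{(1,0)})^2+\xi^2(\alpha^{(0,1)})^2-2\xi\alpha^{(1,0)}\alpha^{(0,1)}\\ &-\alpha\alpha^{(1,0)}\left(2\xi^{(0,1)}-5\Gamma_{22}{}^1\xi^2+2(4\Gamma_{12}{}^1-\Gamma_{22}{}^2)\xi-3\Gamma_{11}{}^1+2\Gamma_{12}{}^2\right)\\ &+\alpha\alpha^{(0,1)}\left(2\xi\xi^{(0,1)}-6\Gamma_{22}{}^1\xi^3+(10\Gamma_{12}{}^1-3\Gamma_{22}{}^2)\xi^2-4(\Gamma_{11}{}^1-\Gamma_{12}{}^2)\xi-\Gamma_{11}{}^2\right)\\ &+6\xi^4\alpha^2(\Gamma_{22}{}^1)^2-2\xi^3\alpha^2\left((\Gamma_{22}{}^1)^{(0,1)}+9\Gamma_{12}{}^1\Gamma_{22}{}^1-3\Gamma_{22}{}^1\Gamma_{22}{}^2\right)\\ &-\xi^2\alpha^2\Big(4\Gamma_{22}{}^1\xi^{(0,1)}-3(\Gamma_{12}{}^1)^{(0,1)}-2(\Gamma_{22}{}^1)^{(1,0)}+(\Gamma_{22}{}^2)^{(0,1)}\\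 &\qquad-12(\Gamma_{12}{}^1)^2-(\Gamma_{22}{}^2)^2-7\Gamma_{11}{}^1\Gamma_{22}{}^1+7\Gamma_{12}{}^1\Gamma_{22}{}^2+9\Gamma_{12}{}^2\Gamma_{22}{}^1\Big)\\ &+\xi\alpha^2\Big(2(3\Gamma_{12}{}^1-\Gamma_{22}{}^2)\xi^{(0,1)}-(\Gamma_{11}{}^1)^{(0,1)}-3(\Gamma_{12}{}^1)^{(1,0)}+(\Gamma_{12}{}^2)^{(0,1)}\\ &\qquad+(\Gamma_{22}{}^2)^{(1,0)}-2(\Gamma_{11}{}^1-\Gamma_{12}{}^2)(4\Gamma_{12}{}^1-\Gamma_{22}{}^2)+4\Gamma_{11}{}^2\Gamma_{22}{}^1\Big)\\ &-\alpha^2\Big(2(\Gamma_{11}{}^1-\Gamma_{12}{}^2)\xi^{(0,1)}-(\Gamma_{11}{}^1)^{(1,0)}+(\Gamma_{12}{}^2)^{(1,0)}\\ &\qquad-(\Gamma_{11}{}^1)^2+\Gamma_{11}{}^1\Gamma_{12}{}^2+3\Gamma_{11}{}^2\Gamma_{12}{}^1-\Gamma_{11}{}^2\Gamma_{22}{}^2\Big). \end{aligned}$$ *)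

theory Defs
  imports "HOL-Analysis.Analysis"
begin

section \<open>Smooth functions\<close>

definition partial :: "'n::finite \<Rightarrow> (real^'n \<Rightarrow> real) \<Rightarrow> real^'n \<Rightarrow> real" where
  "partial i f x = deriv (\<lambda>t. f (x + t *\<^sub>R axis i 1)) 0"

text \<open>The predicates below are meant for open sets \<open>U\<close>.\<close>

fun Ck_on :: "nat \<Rightarrow> (real^'n::finite) set \<Rightarrow> (real^'n \<Rightarrow> real) \<Rightarrow> bool" where
  "Ck_on 0 U f \<longleftrightarrow> continuous_on U f"
| "Ck_on (Suc k) U f \<longleftrightarrow> f differentiable_on U \<and> (\<forall>i. Ck_on k U (partial i f))"

definition smooth_on :: "(real^'n::finite) set \<Rightarrow> (real^'n \<Rightarrow> real) \<Rightarrow> bool" where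
  "smooth_on U f \<longleftrightarrow> (\<forall>k. Ck_on k U f)"


section \<open>Pseudo-Riemannian geometry in a coordinate system\<close>

text \<open>
  A connection is given by its Christoffel symbols, with \<open>\<Gamma> x i j k\<close> standing for
  \<open>\<Gamma>\<^sub>i\<^sub>j\<^sup>k(x)\<close>, i.e. the covariant derivative of the \<open>j\<close>-th coordinate field in the
  direction of the \<open>i\<close>-th has \<open>k\<close>-th component \<open>\<Gamma> x i j k\<close>.
  A metric is given by its component matrix \<open>g x $ i $ j\<close>.
\<close>

type_synonym 'n connection = "real^'n \<Rightarrow> 'n \<Rightarrow> 'n \<Rightarrow> 'n \<Rightarrow> real"
type_synonym 'n metric = "real^'n \<Rightarrow> real^'n^'n"
type_synonym 'n tensor = "real^'n \<Rightarrow> 'n list \<Rightarrow> real"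

definition metric_inv :: "'n::finite metric \<Rightarrow> real^'n \<Rightarrow> 'n \<Rightarrow> 'n \<Rightarrow> real" where
  "metric_inv g x i j = matrix_inv (g x) $ i $ j"

definition levi_civita :: "'n::finite metric \<Rightarrow> 'n connection" where
  "levi_civita g x i j k = 1/2 * (\<Sum>l\<in>UNIV. metric_inv g x k l *
     (partial i (\<lambda>z. g z $ j $ l) x + partial j (\<lambda>z. g z $ i $ l) x
       - partial l (\<lambda>z. g z $ i $ j) x))"

text \<open>Torsion-freeness and compatibility with the metric.\<close>

lemma levi_civita_torsion_free:
  assumes "\<And>z i j. g z $ i $ j = g z $ j $ i"
  shows "levi_civita g x i j k = levi_civita g x j i k"
proof -
  have "(\<lambda>z. g z $ i $ j) = (\<lambda>z. g z $ j $ i)"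
    using assms by blast
  then show ?thesis
    by (simp add: levi_civita_def add.commute)
qed

lemma levi_civita_lower:
  assumes "invertible (g x)" and sym: "\<And>z i j. g z $ i $ j = g z $ j $ i"
  shows "(\<Sum>k\<in>UNIV. levi_civita g x i j k * g x $ k $ l) =
    1/2 * (partial i (\<lambda>z. g z $ j $ l) x + partial j (\<lambda>z. g z $ i $ l) x
       - partial l (\<lambda>z. g z $ i $ j) x)"
proof -
  define c where "c m = 1/2 * (partial i (\<lambda>z. g z $ j $ m) x + partial j (\<lambda>z. g z $ i $ m) x
       - partial m (\<lambda>z. g z $ i $ j) x)" for m
  have inv: "(\<Sum>k\<in>UNIV. g x $ l $ k * metric_inv g x k m) = (if l = m then 1 else 0)" for m
  proof -
    have "g x ** matrix_inv (g x) = mat 1"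
      using someI_ex[OF assms(1)[unfolded invertible_def]] by (simp add: matrix_inv_def)
    then have "(g x ** matrix_inv (g x)) $ l $ m = mat 1 $ l $ m"
      by simp
    then show ?thesis
      by (simp add: matrix_matrix_mult_def metric_inv_def mat_def)
  qed
  have "(\<Sum>k\<in>UNIV. levi_civita g x i j k * g x $ k $ l) =
      (\<Sum>k\<in>UNIV. \<Sum>m\<in>UNIV. g x $ l $ k * metric_inv g x k m * c m)"
    by (intro sum.cong)
      (simp_all add: levi_civita_def c_def sum_distrib_left sum_distrib_right sym[of x _ l]
        algebra_simps)
  also have "\<dots> = (\<Sum>m\<in>UNIV. (\<Sum>k\<in>UNIV. g x $ l $ k * metric_inv g x k m) * c m)"
    by (subst sum.swap) (simp add: sum_distrib_right)
  also have "\<dots> = c l"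
    by (simp add: inv if_distrib[of "\<lambda>t. t * _"] cong: if_cong)
  finally show ?thesis
    by (simp add: c_def)
qed

lemma levi_civita_compatible:
  assumes "invertible (g x)" and sym: "\<And>z i j. g z $ i $ j = g z $ j $ i"
  shows "partial k (\<lambda>z. g z $ i $ j) x =
    (\<Sum>l\<in>UNIV. levi_civita g x k i l * g x $ l $ j) +
    (\<Sum>l\<in>UNIV. levi_civita g x k j l * g x $ l $ i)"
proof -
  have swap: "(\<lambda>z. g z $ a $ b) = (\<lambda>z. g z $ b $ a)" for a b
    using sym by blast
  show ?thesis
    using swap[of i j] swap[of k i] swap[of k j]
    by (simp add: levi_civita_lower[of g x, OF assms] field_simps)
qed

text \<open>
  \<open>curvature_op \<Gamma> x i j k l\<close> is the \<open>l\<close>-th component of \<open>R(\<partial>\<^sub>i,\<partial>\<^sub>j)\<partial>\<^sub>k\<close>, where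
  \<open>R(X,Y) = \<nabla>\<^sub>X \<nabla>\<^sub>Y - \<nabla>\<^sub>Y \<nabla>\<^sub>X - \<nabla>\<^bsub>[X,Y]\<^esub>\<close>, and \<open>riemann g x i j k l = g(R(\<partial>\<^sub>i,\<partial>\<^sub>j)\<partial>\<^sub>k, \<partial>\<^sub>l)\<close>.
  The Ricci tensor is \<open>\<rho>(Y,Z) = tr(X \<mapsto> R(X,Y)Z)\<close>, which is positive on round spheres.
\<close>

definition curvature_op ::
  "'n::finite connection \<Rightarrow> real^'n \<Rightarrow> 'n \<Rightarrow> 'n \<Rightarrow> 'n \<Rightarrow> 'n \<Rightarrow> real" where
  "curvature_op \<Gamma> x i j k l =
     partial i (\<lambda>z. \<Gamma> z j k l) x - partial j (\<lambda>z. \<Gamma> z i k l) x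
     + (\<Sum>m\<in>UNIV. \<Gamma> x j k m * \<Gamma> x i m l - \<Gamma> x i k m * \<Gamma> x j m l)"

definition riemann :: "'n::finite metric \<Rightarrow> real^'n \<Rightarrow> 'n \<Rightarrow> 'n \<Rightarrow> 'n \<Rightarrow> 'n \<Rightarrow> real" where
  "riemann g x i j k l = (\<Sum>m\<in>UNIV. curvature_op (levi_civita g) x i j k m * g x $ m $ l)"

definition ricci :: "'n::finite metric \<Rightarrow> real^'n \<Rightarrow> 'n \<Rightarrow> 'n \<Rightarrow> real" where
  "ricci g x j k = (\<Sum>i\<in>UNIV. curvature_op (levi_civita g) x i j k i)"

definition scalar_curvature :: "'n::finite metric \<Rightarrow> real^'n \<Rightarrow> real" where
  "scalar_curvature g x = (\<Sum>j\<in>UNIV. \<Sum>k\<in>UNIV. metric_inv g x j k * ricci g x j k)"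

text \<open>The totally trace-free part of the curvature tensor, in dimension at least three.\<close>

definition weyl :: "'n::finite metric \<Rightarrow> real^'n \<Rightarrow> 'n \<Rightarrow> 'n \<Rightarrow> 'n \<Rightarrow> 'n \<Rightarrow> real" where
  "weyl g x i j k l =
     riemann g x i j k l
     - 1 / (real CARD('n) - 2) *
         (ricci g x j k * g x $ i $ l - ricci g x i k * g x $ j $ l
          + g x $ j $ k * ricci g x i l - g x $ i $ k * ricci g x j l)
     + scalar_curvature g x / ((real CARD('n) - 1) * (real CARD('n) - 2)) *
         (g x $ j $ k * g x $ i $ l - g x $ i $ k * g x $ j $ l)"

text \<open>
  Covariant derivative of a covariant tensor field of arbitrary rank, whose components are
  indexed by lists; the new index comes first, so \<open>nabla \<Gamma> A x (m # is) = (\<nabla>\<^sub>m A)\<^bsub>is\<^esub>(x)\<close>.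
\<close>

fun nabla :: "'n::finite connection \<Rightarrow> 'n tensor \<Rightarrow> 'n tensor" where
  "nabla \<Gamma> A x (m # is) =
     partial m (\<lambda>z. A z is) x
     - (\<Sum>s<length is. \<Sum>l\<in>UNIV. \<Gamma> x m (is ! s) l * A x (is[s := l]))"
| "nabla \<Gamma> A x [] = 0"

fun weyl_tensor :: "'n::finite metric \<Rightarrow> 'n tensor" where
  "weyl_tensor g x [i, j, k, l] = weyl g x i j k l"
| "weyl_tensor g x _ = 0"

text \<open>
  \<open>\<nabla>\<^sup>k \<nabla>\<^sup>l W\<^sub>k\<^sub>i\<^sub>j\<^sub>l + 1/2 \<rho>\<^sup>k\<^sup>l W\<^sub>k\<^sub>i\<^sub>j\<^sub>l\<close>; these coefficients are those of dimension four.
\<close>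

definition bach :: "'n::finite metric \<Rightarrow> real^'n \<Rightarrow> 'n \<Rightarrow> 'n \<Rightarrow> real" where
  "bach g x i j =
     (\<Sum>k\<in>UNIV. \<Sum>l\<in>UNIV. \<Sum>a\<in>UNIV. \<Sum>b\<in>UNIV. metric_inv g x k a * metric_inv g x l b *
        nabla (levi_civita g) (nabla (levi_civita g) (weyl_tensor g)) x [a, b, k, i, j, l])
     + 1/2 * (\<Sum>k\<in>UNIV. \<Sum>l\<in>UNIV. \<Sum>a\<in>UNIV. \<Sum>b\<in>UNIV.
        metric_inv g x k a * metric_inv g x l b * ricci g x a b * weyl g x k i j l)"

definition bach_flat_on :: "(real^'n::finite) set \<Rightarrow> 'n metric \<Rightarrow> bool" where
  "bach_flat_on S g \<longleftrightarrow> (\<forall>x\<in>S. \<forall>i j. bach g x i j = 0)"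


section \<open>Affine surfaces and modified Riemannian extensions\<close>

text \<open>An affine surface covered by one coordinate system with image \<open>U\<close>.\<close>

definition affine_surface :: "(real^2) set \<Rightarrow> 2 connection \<Rightarrow> bool" where
  "affine_surface U \<Gamma> \<longleftrightarrow> open U \<and>
     (\<forall>i j k. smooth_on U (\<lambda>x. \<Gamma> x i j k)) \<and>
     (\<forall>x\<in>U. \<forall>i j k. \<Gamma> x i j k = \<Gamma> x j i k)"

definition smooth_sym_2tensor :: "(real^2) set \<Rightarrow> (real^2 \<Rightarrow> real^2^2) \<Rightarrow> bool" where
  "smooth_sym_2tensor U \<Phi> \<longleftrightarrow>
     (\<forall>i j. smooth_on U (\<lambda>x. \<Phi> x $ i $ j)) \<and> (\<forall>x\<in>U. \<forall>i j. \<Phi> x $ i $ j = \<Phi> x $ j $ i)"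

text \<open>
  Points of the cotangent bundle are written in the induced coordinates \<open>(x\<^sup>1, x\<^sup>2, y\<^sub>1, y\<^sub>2)\<close>,
  indexed by the sum type \<open>2 + 2\<close>: \<open>Inl i\<close> is the index of \<open>x\<^sup>i\<close> and \<open>Inr i\<close> that of \<open>y\<^sub>i\<close>.
\<close>

definition base_pt :: "real^(2 + 2) \<Rightarrow> real^2" where
  "base_pt p = (\<chi> i. p $ Inl i)"

definition fiber_pt :: "real^(2 + 2) \<Rightarrow> real^2" where
  "fiber_pt p = (\<chi> i. p $ Inr i)"

definition cotangent_bundle :: "(real^2) set \<Rightarrow> (real^(2 + 2)) set" where
  "cotangent_bundle U = {p. base_pt p \<in> U}"

text \<open>A \<open>(1,1)\<close> tensor field is given by its matrix, with \<open>T x $ r $ i\<close> for \<open>T\<^sup>r\<^sub>i(x)\<close>.\<close>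

definition ext_xx :: "(real^2 \<Rightarrow> real^2^2) \<Rightarrow> 2 connection \<Rightarrow> (real^2 \<Rightarrow> real^2^2) \<Rightarrow>
    real^2 \<Rightarrow> real^2 \<Rightarrow> 2 \<Rightarrow> 2 \<Rightarrow> real" where
  "ext_xx T \<Gamma> \<Phi> x y i j =
     1/2 * (\<Sum>r\<in>UNIV. \<Sum>s\<in>UNIV. y $ r * y $ s *
       (T x $ r $ i * T x $ s $ j + T x $ r $ j * T x $ s $ i))
     - 2 * (\<Sum>k\<in>UNIV. y $ k * \<Gamma> x i j k) + \<Phi> x $ i $ j"

definition riemannian_extension ::
  "(real^2 \<Rightarrow> real^2^2) \<Rightarrow> 2 connection \<Rightarrow> (real^2 \<Rightarrow> real^2^2) \<Rightarrow> (2 + 2) metric" where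
  "riemannian_extension T \<Gamma> \<Phi> p = (\<chi> a b. case (a, b) of
       (Inl i, Inl j) \<Rightarrow> ext_xx T \<Gamma> \<Phi> (base_pt p) (fiber_pt p) i j
     | (Inl i, Inr j) \<Rightarrow> if i = j then 1 else 0
     | (Inr i, Inl j) \<Rightarrow> if i = j then 1 else 0
     | (Inr i, Inr j) \<Rightarrow> 0)"

lemma sum_UNIV_sum_type:
  fixes f :: "'a::finite + 'b::finite \<Rightarrow> 'c::comm_monoid_add"
  shows "(\<Sum>c\<in>UNIV. f c) = (\<Sum>i\<in>UNIV. f (Inl i)) + (\<Sum>i\<in>UNIV. f (Inr i))"
  by (simp add: UNIV_Plus_UNIV[symmetric] sum.Plus del: UNIV_Plus_UNIV)

lemma invertible_riemannian_extension: "invertible (riemannian_extension T \<Gamma> \<Phi> p)"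
proof -
  let ?e = "ext_xx T \<Gamma> \<Phi> (base_pt p) (fiber_pt p)"
  define h :: "real^(2 + 2)^(2 + 2)" where "h = (\<chi> a b. case (a, b) of
       (Inl i, Inl j) \<Rightarrow> 0
     | (Inl i, Inr j) \<Rightarrow> if i = j then 1 else 0
     | (Inr i, Inl j) \<Rightarrow> if i = j then 1 else 0
     | (Inr i, Inr j) \<Rightarrow> - ?e i j)"
  have "riemannian_extension T \<Gamma> \<Phi> p ** h = mat 1"
  proof -
    have delta: "(\<Sum>k\<in>UNIV. (if i = k then 1 else 0) * f k) = f i"
      "(\<Sum>k\<in>UNIV. f k * (if k = i then 1 else 0)) = f i" for i :: 2 and f :: "2 \<Rightarrow> real"
      by (simp_all add: if_distrib[of "\<lambda>t. t * _"] if_distrib[of "\<lambda>t. _ * t"] cong: if_cong)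
    have "(riemannian_extension T \<Gamma> \<Phi> p ** h) $ a $ b = mat 1 $ a $ b" for a b
      by (cases a; cases b)
        (simp_all add: matrix_matrix_mult_def mat_def h_def riemannian_extension_def
          sum_UNIV_sum_type delta)
    then show ?thesis
      by (simp add: vec_eq_iff)
  qed
  then show ?thesis
    by (auto simp: invertible_right_inverse)
qed


section \<open>The differential operators\<close>

definition pd :: "nat \<Rightarrow> nat \<Rightarrow> (real^2 \<Rightarrow> real) \<Rightarrow> real^2 \<Rightarrow> real" where
  "pd a b f = (partial 1 ^^ a) ((partial 2 ^^ b) f)"

definition P1 :: "2 connection \<Rightarrow> (real^2 \<Rightarrow> real) \<Rightarrow> real^2 \<Rightarrow> real" where
  "P1 \<Gamma> \<xi> x =
     - pd 1 0 \<xi> x + \<xi> x * pd 0 1 \<xi> x + \<Gamma> x 2 2 1 * \<xi> x ^ 3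
     - (2 * \<Gamma> x 1 2 1 - \<Gamma> x 2 2 2) * \<xi> x ^ 2
     + (\<Gamma> x 1 1 1 - 2 * \<Gamma> x 1 2 2) * \<xi> x + \<Gamma> x 1 1 2"

definition P2 :: "2 connection \<Rightarrow> (real^2 \<Rightarrow> real) \<Rightarrow> (real^2 \<Rightarrow> real) \<Rightarrow> real^2 \<Rightarrow> real" where
  "P2 \<Gamma> \<xi> \<alpha> x = (let
       u = \<xi> x; a = \<alpha> x;
       G111 = \<Gamma> x 1 1 1; G112 = \<Gamma> x 1 1 2; G121 = \<Gamma> x 1 2 1;
       G122 = \<Gamma> x 1 2 2; G221 = \<Gamma> x 2 2 1; G222 = \<Gamma> x 2 2 2;
       dG = (\<lambda>m n i j k. pd m n (\<lambda>z. \<Gamma> z i j k) x)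
     in
       a * pd 2 0 \<alpha> x + u^2 * a * pd 0 2 \<alpha> x - 2 * u * a * pd 1 1 \<alpha> x
       + (pd 1 0 \<alpha> x)^2 + u^2 * (pd 0 1 \<alpha> x)^2 - 2 * u * pd 1 0 \<alpha> x * pd 0 1 \<alpha> x
       - a * pd 1 0 \<alpha> x *
           (2 * pd 0 1 \<xi> x - 5 * G221 * u^2 + 2 * (4 * G121 - G222) * u - 3 * G111 + 2 * G122)
       + a * pd 0 1 \<alpha> x *
           (2 * u * pd 0 1 \<xi> x - 6 * G221 * u^3 + (10 * G121 - 3 * G222) * u^2
            - 4 * (G111 - G122) * u - G112)
       + 6 * u^4 * a^2 * G221^2
       - 2 * u^3 * a^2 * (dG 0 1 2 2 1 + 9 * G121 * G221 - 3 * G221 * G222)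
       - u^2 * a^2 *
           (4 * G221 * pd 0 1 \<xi> x - 3 * dG 0 1 1 2 1 - 2 * dG 1 0 2 2 1 + dG 0 1 2 2 2
            - 12 * G121^2 - G222^2 - 7 * G111 * G221 + 7 * G121 * G222 + 9 * G122 * G221)
       + u * a^2 *
           (2 * (3 * G121 - G222) * pd 0 1 \<xi> x - dG 0 1 1 1 1 - 3 * dG 1 0 1 2 1
            + dG 0 1 1 2 2 + dG 1 0 2 2 2
            - 2 * (G111 - G122) * (4 * G121 - G222) + 4 * G112 * G221)
       - a^2 *
           (2 * (G111 - G122) * pd 0 1 \<xi> x - dG 1 0 1 1 1 + dG 1 0 1 2 2
            - G111^2 + G111 * G122 + 3 * G112 * G121 - G112 * G222))"

end

theory Submission
  imports Defs
begin

text \<open>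
  At a point of \<open>T\<^sup>*M\<close> the Bach tensor is a polynomial with rational coefficients in the fibre
  coordinates and the partial derivatives of \<open>\<alpha>\<close>, \<open>\<xi>\<close>, \<open>\<Gamma>\<close> and \<open>\<Phi>\<close>. Almost everything cancels: the only
  components that survive are \<open>B\<^sub>1\<^sub>1\<close>, \<open>B\<^sub>1\<^sub>2\<close> and \<open>B\<^sub>2\<^sub>2\<close> along the base, they depend neither on \<open>\<Phi>\<close> nor on
  the fibre coordinates, and

    \<open>B\<^sub>1\<^sub>1 - 2 \<xi> B\<^sub>1\<^sub>2 + \<xi>\<^sup>2 B\<^sub>2\<^sub>2 = - 4 \<alpha>\<^sup>2 P1\<^sup>2\<close>,   \<open>B\<^sub>1\<^sub>2 - \<xi> B\<^sub>2\<^sub>2 = E\<^sub>1\<^sub>2\<close>,   \<open>B\<^sub>2\<^sub>2 = - 4 P2 + E\<^sub>2\<^sub>2\<close>,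

  where \<open>E\<^sub>1\<^sub>2\<close> and \<open>E\<^sub>2\<^sub>2\<close> are linear in \<open>P1\<close> and its first derivatives. Hence Bach flatness forces
  \<open>P1 = 0\<close> on \<open>U\<close>, after which all components are controlled by \<open>P2\<close>.

  The identities are proved by computing with formal differential polynomials, whose evaluation
  homomorphism turns the formal derivatives into \<open>partial\<close>. Taking the two divergences one after the
  other keeps this computation small; this is legitimate because the inverse metric is parallel.
\<close>

section \<open>Partial derivatives\<close>

lemma partial_eq_derivative:
  assumes "(f has_derivative f') (at x)"
  shows "partial i f x = f' (axis i 1)"
proof -
  have "((\<lambda>t::real. x + t *\<^sub>R axis i 1) has_derivative (\<lambda>t. t *\<^sub>R axis i 1)) (at 0)"
    by (auto intro!: derivative_eq_intros)
  moreover have "(f has_derivative f') (at (x + 0 *\<^sub>R axis i 1))"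
    using assms by simp
  ultimately have "((\<lambda>t. f (x + t *\<^sub>R axis i 1)) has_derivative (\<lambda>t. f' (t *\<^sub>R axis i 1))) (at 0)"
    by (rule has_derivative_compose)
  moreover have "f' (t *\<^sub>R axis i 1) = f' (axis i 1) * t" for t
    using linear_scale[OF has_derivative_linear[OF assms]] by simp
  ultimately show ?thesis
    unfolding partial_def by (intro DERIV_imp_deriv) (simp add: has_field_derivative_def)
qed

text \<open>Partial derivatives are local: the line through \<open>x\<close> stays in the open set
  for small parameters. Equalities known only on \<open>U\<close> or on
  \<open>cotangent_bundle U\<close> can therefore be differentiated.\<close>

lemma partial_cong:
  assumes "open S" "x \<in> S" "\<And>z. z \<in> S \<Longrightarrow> f z = g z"
  shows "partial i f x = partial i g x"
proof -
  have "((\<lambda>t::real. x + t *\<^sub>R axis i 1) \<longlongrightarrow> x + 0 *\<^sub>R axis i 1) (nhds 0)"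
    by (intro tendsto_intros filterlim_ident)
  then have "\<forall>\<^sub>F t::real in nhds 0. x + t *\<^sub>R axis i 1 \<in> S"
    using assms(1,2) by (auto dest: topological_tendstoD)
  then have "\<forall>\<^sub>F t in nhds 0. f (x + t *\<^sub>R axis i 1) = g (x + t *\<^sub>R axis i 1)"
    by eventually_elim (rule assms(3))
  then show ?thesis
    unfolding partial_def by (rule deriv_cong_ev) simp
qed

lemma partial_const: "partial i (\<lambda>z. c) x = 0"
  by (simp add: partial_def)

lemma partial_add:
  assumes "f differentiable at x" "g differentiable at x"
  shows "partial i (\<lambda>z. f z + g z) x = partial i f x + partial i g x"
proof -
  obtain f' g' where f': "(f has_derivative f') (at x)" and g': "(g has_derivative g') (at x)"
    using assms unfolding differentiable_def by blast
  show ?thesis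
    unfolding partial_eq_derivative[OF has_derivative_add[OF f' g']]
      partial_eq_derivative[OF f'] partial_eq_derivative[OF g'] by simp
qed

lemma partial_mult:
  assumes "f differentiable at x" "g differentiable at x"
  shows "partial i (\<lambda>z. f z * g z) x = partial i f x * g x + f x * partial i g x"
proof -
  obtain f' g' where f': "(f has_derivative f') (at x)" and g': "(g has_derivative g') (at x)"
    using assms unfolding differentiable_def by blast
  show ?thesis
    unfolding partial_eq_derivative[OF has_derivative_mult[OF f' g']]
      partial_eq_derivative[OF f'] partial_eq_derivative[OF g'] by simp
qed

lemma partial_cmult:
  assumes "f differentiable at x"
  shows "partial i (\<lambda>z. c * f z) x = c * partial i f x"
  using partial_mult[of "\<lambda>_. c" x f i] assms by (simp add: partial_const)

lemma partial_sum:
  assumes "finite A" "\<And>a. a \<in> A \<Longrightarrow> f a differentiable at x"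
  shows "partial i (\<lambda>z. \<Sum>a\<in>A. f a z) x = (\<Sum>a\<in>A. partial i (f a) x)"
  using assms by (induction A rule: finite_induct)
    (simp_all add: partial_const partial_add differentiable_sum)

section \<open>Smooth functions and the symmetry of mixed partial derivatives\<close>

lemma smooth_on_partial: "smooth_on U f \<Longrightarrow> smooth_on U (partial i f)"
  unfolding smooth_on_def by (metis Ck_on.simps(2))

lemma smooth_on_differentiable:
  assumes "smooth_on U f" "open U" "x \<in> U"
  shows "f differentiable at x"
proof -
  have "f differentiable_on U"
    using assms(1) unfolding smooth_on_def by (metis Ck_on.simps(2))
  then show ?thesis
    using assms(2,3) by (simp add: differentiable_on_eq_differentiable_at)
qed

lemma smooth_on_continuous: "smooth_on U f \<Longrightarrow> continuous_on U f"
  unfolding smooth_on_def by (metis Ck_on.simps(1))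

lemma has_derivative_along:
  assumes "f differentiable at (x + s *\<^sub>R axis i 1)"
  shows "((\<lambda>s. f (x + s *\<^sub>R axis i 1)) has_real_derivative partial i f (x + s *\<^sub>R axis i 1)) (at s)"
proof -
  obtain f' where f': "(f has_derivative f') (at (x + s *\<^sub>R axis i 1))"
    using assms unfolding differentiable_def by blast
  have "((\<lambda>t::real. x + t *\<^sub>R axis i 1) has_derivative (\<lambda>t. t *\<^sub>R axis i 1)) (at s)"
    by (auto intro!: derivative_eq_intros)
  from has_derivative_compose[OF this f']
  show ?thesis
    using linear_scale[OF has_derivative_linear[OF f']]
    by (simp add: has_field_derivative_def partial_eq_derivative[OF f'] mult.commute[of _ "f' _"])
qed

text \<open>The mean value theorem is applied twice: in direction \<open>i\<close> to the increment
  of \<open>f\<close> along \<open>j\<close>, then in direction \<open>j\<close> to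
  \<open>partial i f\<close>. The bound \<open>2 * h < r\<close> keeps the whole parallelogram in
  the ball.\<close>

lemma second_difference:
  fixes f :: "real^'n::finite \<Rightarrow> real"
  assumes f: "\<And>z. z \<in> ball x r \<Longrightarrow> f differentiable at z"
    and f': "\<And>z. z \<in> ball x r \<Longrightarrow> partial i f differentiable at z"
    and h: "0 < h" "2 * h < r"
  obtains z where "dist z x \<le> 2 * h"
    "f (x + h *\<^sub>R axis i 1 + h *\<^sub>R axis j 1) - f (x + h *\<^sub>R axis i 1) - f (x + h *\<^sub>R axis j 1) + f x =
      h\<^sup>2 * partial j (partial i f) z"
proof -
  have near: "dist (x + s *\<^sub>R axis i 1 + t *\<^sub>R axis j 1) x \<le> 2 * h"
    if "0 \<le> s" "s \<le> h" "0 \<le> t" "t \<le> h" for s t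
  proof -
    have "norm (s *\<^sub>R axis i 1 + t *\<^sub>R axis j 1 :: real^'n) \<le> s + t"
      using norm_triangle_ineq[of "s *\<^sub>R axis i 1 :: real^'n" "t *\<^sub>R axis j 1"] that by simp
    then show ?thesis
      using that by (simp add: dist_norm add.assoc)
  qed
  then have in_ball: "x + s *\<^sub>R axis i 1 + t *\<^sub>R axis j 1 \<in> ball x r"
    if "0 \<le> s" "s \<le> h" "0 \<le> t" "t \<le> h" for s t
    using that h by (fastforce simp: mem_ball dist_commute)
  define \<phi> where "\<phi> s = f (x + h *\<^sub>R axis j 1 + s *\<^sub>R axis i 1) - f (x + s *\<^sub>R axis i 1)" for s
  have "(\<phi> has_real_derivative
      partial i f (x + h *\<^sub>R axis j 1 + s *\<^sub>R axis i 1) - partial i f (x + s *\<^sub>R axis i 1)) (at s)"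
    if "0 \<le> s" "s \<le> h" for s
    unfolding \<phi>_def using in_ball[OF that, of h] in_ball[OF that, of 0] h
    by (intro DERIV_diff has_derivative_along f) (simp_all add: add_ac)
  from MVT2[OF h(1) this] obtain s where s: "0 < s" "s < h"
    "\<phi> h - \<phi> 0 = (h - 0) * (partial i f (x + h *\<^sub>R axis j 1 + s *\<^sub>R axis i 1) - partial i f (x + s *\<^sub>R axis i 1))"
    by auto
  define \<psi> where "\<psi> t = partial i f (x + s *\<^sub>R axis i 1 + t *\<^sub>R axis j 1)" for t
  have "(\<psi> has_real_derivative partial j (partial i f) (x + s *\<^sub>R axis i 1 + t *\<^sub>R axis j 1)) (at t)"
    if "0 \<le> t" "t \<le> h" for t
    unfolding \<psi>_def using in_ball[of s t] that s by (intro has_derivative_along f') simp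
  from MVT2[OF h(1) this] obtain t where t: "0 < t" "t < h"
    "\<psi> h - \<psi> 0 = (h - 0) * partial j (partial i f) (x + s *\<^sub>R axis i 1 + t *\<^sub>R axis j 1)"
    by auto
  have "\<phi> h - \<phi> 0 = h * (\<psi> h - \<psi> 0)"
    using s(3) by (simp add: \<psi>_def add_ac)
  then have "\<phi> h - \<phi> 0 = h\<^sup>2 * partial j (partial i f) (x + s *\<^sub>R axis i 1 + t *\<^sub>R axis j 1)"
    using t(3) by (simp add: power2_eq_square)
  then show ?thesis
    using near[of s t] s t by (intro that[of "x + s *\<^sub>R axis i 1 + t *\<^sub>R axis j 1"])
      (simp_all add: \<phi>_def add_ac)
qed

text \<open>The second difference is symmetric in \<open>i\<close> and \<open>j\<close>, so the two
  mixed derivatives share a value at points arbitrarily close to \<open>x\<close>. Continuity then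
  excludes different values at \<open>x\<close>.\<close>

lemma partial_commute:
  fixes f :: "real^'n::finite \<Rightarrow> real"
  assumes U: "open U" "x \<in> U" and f: "smooth_on U f"
  shows "partial i (partial j f) x = partial j (partial i f) x"
proof (rule ccontr)
  let ?A = "partial j (partial i f)" and ?B = "partial i (partial j f)"
  assume "\<not> ?thesis"
  then have e: "0 < dist (?A x) (?B x) / 2" by simp
  have cont: "continuous (at x) (partial k (partial l f))" for k l
    using U smooth_on_continuous[OF smooth_on_partial[OF smooth_on_partial[OF f]]]
    by (simp add: continuous_on_eq_continuous_at)
  obtain d1 where d1: "d1 > 0" "\<And>z. dist z x < d1 \<Longrightarrow> dist (?A z) (?A x) < dist (?A x) (?B x) / 2"
    using cont[of j i] e unfolding continuous_at_eps_delta by (metis dist_norm)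
  obtain d2 where d2: "d2 > 0" "\<And>z. dist z x < d2 \<Longrightarrow> dist (?B z) (?B x) < dist (?A x) (?B x) / 2"
    using cont[of i j] e unfolding continuous_at_eps_delta by (metis dist_norm)
  obtain r where r: "r > 0" "ball x r \<subseteq> U"
    using U openE by blast
  define h where "h = min r (min d1 d2) / 3"
  have h: "0 < h" "2 * h < r" "2 * h < d1" "2 * h < d2"
    using r(1) d1(1) d2(1) by (auto simp: h_def min_def)
  have diff: "f differentiable at z" "partial k f differentiable at z" if "z \<in> ball x r" for z k
    using that r(2) U(1) f smooth_on_differentiable smooth_on_partial by blast+
  obtain z where z: "dist z x \<le> 2 * h"
    "f (x + h *\<^sub>R axis i 1 + h *\<^sub>R axis j 1) - f (x + h *\<^sub>R axis i 1) - f (x + h *\<^sub>R axis j 1) + f x = h\<^sup>2 * ?A z"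
    using second_difference[OF diff(1) diff(2) h(1,2)] by blast
  obtain w where w: "dist w x \<le> 2 * h"
    "f (x + h *\<^sub>R axis j 1 + h *\<^sub>R axis i 1) - f (x + h *\<^sub>R axis j 1) - f (x + h *\<^sub>R axis i 1) + f x = h\<^sup>2 * ?B w"
    using second_difference[OF diff(1) diff(2) h(1,2)] by blast
  have eq: "x + h *\<^sub>R axis j 1 + h *\<^sub>R axis i 1 = x + h *\<^sub>R axis i 1 + h *\<^sub>R axis j 1"
    by (simp add: add_ac)
  have "h\<^sup>2 * ?A z = h\<^sup>2 * ?B w"
    using z(2) w(2) unfolding eq by linarith
  then have "?A z = ?B w"
    using h(1) by simp
  moreover have "dist (?A z) (?A x) < dist (?A x) (?B x) / 2" "dist (?B w) (?B x) < dist (?A x) (?B x) / 2"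
    using d1(2) d2(2) z(1) w(1) h by simp_all
  ultimately show False
    using dist_triangle2[of "?A x" "?B x" "?A z"] by (simp add: dist_commute)
qed

lemma smooth_on_pd: "smooth_on U f \<Longrightarrow> smooth_on U (pd a b f)"
proof -
  assume f: "smooth_on U f"
  have "smooth_on U ((partial 2 ^^ b) f)"
    by (induction b) (simp_all add: f smooth_on_partial)
  then have "smooth_on U ((partial 1 ^^ a) ((partial 2 ^^ b) f))"
    by (induction a) (simp_all add: smooth_on_partial)
  then show ?thesis by (simp add: pd_def)
qed

lemma partial_1_pd: "partial 1 (pd a b f) = pd (Suc a) b f"
  by (simp add: pd_def)

text \<open>\<open>pd\<close> applies \<open>partial 2\<close> first, so a further
  \<open>partial 2\<close> has to be moved past each \<open>partial 1\<close>. The commutation holds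
  only on \<open>U\<close>, hence the induction over all points of \<open>U\<close> at once.\<close>

lemma partial_2_pd:
  assumes "open U" "x \<in> U" "smooth_on U f"
  shows "partial 2 (pd a b f) x = pd a (Suc b) f x"
  using assms(2)
proof (induction a arbitrary: x)
  case 0
  then show ?case by (simp add: pd_def)
next
  case (Suc a)
  have "partial 2 (partial 1 (pd a b f)) x = partial 1 (partial 2 (pd a b f)) x"
    using partial_commute assms(1) Suc.prems smooth_on_pd[OF assms(3)] by blast
  also have "\<dots> = partial 1 (pd a (Suc b) f) x"
    using partial_cong[OF assms(1) Suc.prems] Suc.IH by blast
  finally show ?case by (simp add: partial_1_pd)
qed

text \<open>Contraction with a parallel contravariant tensor commutes with covariant
  differentiation. The hypothesis \<open>par\<close> says that \<open>N\<close> is parallel in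
  direction \<open>a\<close>; the first and last slots of \<open>A\<close> are the contracted
  ones.\<close>

lemma nabla_contraction:
  fixes \<Gamma> :: "'n::finite connection" and A :: "'n tensor"
  assumes N: "\<And>l b. N l b differentiable at p"
    and A: "\<And>l b. (\<lambda>z. A z (b # js @ [l])) differentiable at p"
    and par: "\<And>l b. partial a (N l b) p = - (\<Sum>m\<in>UNIV. \<Gamma> p a m l * N m b p + \<Gamma> p a m b * N l m p)"
  shows "(\<Sum>l\<in>UNIV. \<Sum>b\<in>UNIV. N l b p * nabla \<Gamma> A p (a # b # js @ [l])) =
    nabla \<Gamma> (\<lambda>z js. \<Sum>l\<in>UNIV. \<Sum>b\<in>UNIV. N l b z * A z (b # js @ [l])) p (a # js)"
proof -
  let ?n = "length js"
  have shift: "(\<Sum>s<length (b # js @ [l]). \<Sum>m\<in>UNIV. \<Gamma> p a ((b # js @ [l]) ! s) m * A p ((b # js @ [l])[s := m])) =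
      (\<Sum>m\<in>UNIV. \<Gamma> p a b m * A p (m # js @ [l])) +
      (\<Sum>s<?n. \<Sum>m\<in>UNIV. \<Gamma> p a (js ! s) m * A p (b # js[s := m] @ [l])) +
      (\<Sum>m\<in>UNIV. \<Gamma> p a l m * A p (b # js @ [m]))" for l b
  proof -
    have "sum f {..<Suc (Suc n)} = f 0 + (\<Sum>s<n. f (Suc s)) + f (Suc n)" for f :: "nat \<Rightarrow> real" and n
      by (induction n) (simp_all add: add_ac)
    moreover have "length (b # js @ [l]) = Suc (Suc ?n)"
      by simp
    ultimately show ?thesis
      by (simp only:) (simp add: nth_append list_update_append)
  qed
  have der: "partial a (\<lambda>z. \<Sum>l\<in>UNIV. \<Sum>b\<in>UNIV. N l b z * A z (b # js @ [l])) p =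
      (\<Sum>l\<in>UNIV. \<Sum>b\<in>UNIV. partial a (N l b) p * A p (b # js @ [l]) + N l b p * partial a (\<lambda>z. A z (b # js @ [l])) p)"
    by (simp add: partial_sum partial_mult N A differentiable_mult differentiable_sum)
  \<comment> \<open>Renaming summation indices turns the Christoffel terms coming from
    \<open>par\<close> into those of the contracted slots of \<open>A\<close>: \<open>s1\<close>
    treats the last slot, \<open>s2\<close> the first.\<close>
  have s1: "(\<Sum>l\<in>UNIV. \<Sum>b\<in>UNIV. (\<Sum>m\<in>UNIV. \<Gamma> p a m l * N m b p) * A p (b # js @ [l])) =
      (\<Sum>l\<in>UNIV. \<Sum>b\<in>UNIV. N l b p * (\<Sum>m\<in>UNIV. \<Gamma> p a l m * A p (b # js @ [m])))"
  proof -
    have "(\<Sum>l\<in>UNIV. \<Sum>b\<in>UNIV. (\<Sum>m\<in>UNIV. \<Gamma> p a m l * N m b p) * A p (b # js @ [l])) =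
      (\<Sum>l\<in>UNIV. \<Sum>m\<in>UNIV. \<Sum>b\<in>UNIV. \<Gamma> p a m l * N m b p * A p (b # js @ [l]))"
      by (simp add: sum_distrib_right) (intro sum.cong refl sum.swap)
    also have "\<dots> = (\<Sum>m\<in>UNIV. \<Sum>l\<in>UNIV. \<Sum>b\<in>UNIV. \<Gamma> p a m l * N m b p * A p (b # js @ [l]))"
      by (rule sum.swap)
    also have "\<dots> = (\<Sum>m\<in>UNIV. \<Sum>b\<in>UNIV. \<Sum>l\<in>UNIV. \<Gamma> p a m l * N m b p * A p (b # js @ [l]))"
      by (intro sum.cong refl sum.swap)
    finally show ?thesis
      by (simp add: sum_distrib_left mult_ac)
  qed
  have s2: "(\<Sum>l\<in>UNIV. \<Sum>b\<in>UNIV. (\<Sum>m\<in>UNIV. \<Gamma> p a m b * N l m p) * A p (b # js @ [l])) =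
      (\<Sum>l\<in>UNIV. \<Sum>b\<in>UNIV. N l b p * (\<Sum>m\<in>UNIV. \<Gamma> p a b m * A p (m # js @ [l])))"
  proof -
    have "(\<Sum>b\<in>UNIV. (\<Sum>m\<in>UNIV. G m b * n m) * c b) = (\<Sum>b\<in>UNIV. n b * (\<Sum>m\<in>UNIV. G b m * c m))"
      for G :: "'n \<Rightarrow> 'n \<Rightarrow> real" and n c
      by (simp only: sum_distrib_left sum_distrib_right, subst sum.swap) (simp add: mult_ac)
    then show ?thesis
      by simp
  qed
  have s3: "(\<Sum>s<?n. \<Sum>m\<in>UNIV. \<Gamma> p a (js ! s) m * (\<Sum>l\<in>UNIV. \<Sum>b\<in>UNIV. N l b p * A p (b # js[s := m] @ [l]))) =
      (\<Sum>l\<in>UNIV. \<Sum>b\<in>UNIV. N l b p * (\<Sum>s<?n. \<Sum>m\<in>UNIV. \<Gamma> p a (js ! s) m * A p (b # js[s := m] @ [l])))"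
  proof -
    have swap: "(\<Sum>m\<in>M. \<Sum>l\<in>UNIV. \<Sum>b\<in>UNIV. f m l b) = (\<Sum>l\<in>UNIV. \<Sum>b\<in>UNIV. \<Sum>m\<in>M. f m l b)"
      for M :: "'m set" and f :: "'m \<Rightarrow> 'n \<Rightarrow> 'n \<Rightarrow> real"
      by (subst sum.swap, intro sum.cong refl sum.swap)
    have "(\<Sum>s<?n. \<Sum>m\<in>UNIV. \<Gamma> p a (js ! s) m * (\<Sum>l\<in>UNIV. \<Sum>b\<in>UNIV. N l b p * A p (b # js[s := m] @ [l]))) =
        (\<Sum>s<?n. \<Sum>l\<in>UNIV. \<Sum>b\<in>UNIV. \<Sum>m\<in>UNIV. \<Gamma> p a (js ! s) m * (N l b p * A p (b # js[s := m] @ [l])))"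
      unfolding sum_distrib_left by (intro sum.cong refl swap)
    also have "\<dots> = (\<Sum>l\<in>UNIV. \<Sum>b\<in>UNIV. \<Sum>s<?n. \<Sum>m\<in>UNIV. \<Gamma> p a (js ! s) m * (N l b p * A p (b # js[s := m] @ [l])))"
      by (rule swap)
    finally show ?thesis
      by (simp add: sum_distrib_left mult_ac)
  qed
  show ?thesis
    unfolding nabla.simps(1) shift der s3 par
    by (simp add: algebra_simps sum.distrib sum_subtractf sum_negf s1[symmetric] s2[symmetric])
qed

section \<open>Differential polynomials\<close>

text \<open>
  \<open>Y1\<close>, \<open>Y2\<close> are the fibre coordinates, \<open>Jet f a b\<close> is the derivative of order \<open>(a, b)\<close> of the function
  number \<open>f\<close>, and \<open>Hor x p q\<close> stands for \<open>x * p + q\<close>. Polynomials met in the computation are in Horner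
  form with increasing variables, so that equal polynomials become syntactically equal; no proof
  relies on this invariant.
\<close>

datatype jvar = Y1 | Y2 | Jet nat nat nat
datatype dpoly = Cst int | Hor jvar dpoly dpoly
datatype comp = Lt | Eq | Gt

text \<open>The third argument is the verdict in case of a tie, so that nested calls compare
  lexicographically.\<close>

fun ncomp :: "nat \<Rightarrow> nat \<Rightarrow> comp \<Rightarrow> comp" where
  "ncomp 0 0 c = c"
| "ncomp 0 (Suc n) c = Lt"
| "ncomp (Suc m) 0 c = Gt"
| "ncomp (Suc m) (Suc n) c = ncomp m n c"

fun jcomp :: "jvar \<Rightarrow> jvar \<Rightarrow> comp" where
  "jcomp Y1 Y1 = Eq"
| "jcomp Y1 Y2 = Lt"
| "jcomp Y1 (Jet f a b) = Lt"
| "jcomp Y2 Y1 = Gt"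
| "jcomp Y2 Y2 = Eq"
| "jcomp Y2 (Jet f a b) = Lt"
| "jcomp (Jet f a b) Y1 = Gt"
| "jcomp (Jet f a b) Y2 = Gt"
| "jcomp (Jet f a b) (Jet f' a' b') = ncomp f f' (ncomp a a' (ncomp b b' Eq))"

text \<open>
  The functions \<open>_cases\<close> dispatch on an evaluated condition. With \<open>if\<close> or \<open>case\<close> instead, the simplifier
  would normalise the selected branch a second time, which makes the evaluation quadratic.
\<close>

fun hor_cases :: "bool \<Rightarrow> jvar \<Rightarrow> int \<Rightarrow> dpoly \<Rightarrow> dpoly" where
  "hor_cases True x c q = q"
| "hor_cases False x c q = Hor x (Cst c) q"

fun hor :: "jvar \<Rightarrow> dpoly \<Rightarrow> dpoly \<Rightarrow> dpoly" where
  "hor x (Cst c) q = hor_cases (c = 0) x c q"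
| "hor x (Hor y a b) q = Hor x (Hor y a b) q"

function (sequential) padd :: "dpoly \<Rightarrow> dpoly \<Rightarrow> dpoly"
  and padd_cases :: "comp \<Rightarrow> jvar \<Rightarrow> dpoly \<Rightarrow> dpoly \<Rightarrow> jvar \<Rightarrow> dpoly \<Rightarrow> dpoly \<Rightarrow> dpoly" where
  "padd (Cst a) (Cst b) = Cst (a + b)"
| "padd (Cst a) (Hor y r s) = Hor y r (padd (Cst a) s)"
| "padd (Hor x p q) (Cst b) = Hor x p (padd q (Cst b))"
| "padd (Hor x p q) (Hor y r s) = padd_cases (jcomp x y) x p q y r s"
| "padd_cases Lt x p q y r s = Hor x p (padd q (Hor y r s))"
| "padd_cases Eq x p q y r s = hor x (padd p r) (padd q s)"
| "padd_cases Gt x p q y r s = Hor y r (padd (Hor x p q) s)"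
  by pat_completeness auto
text \<open>Doubling the size leaves room for an odd value, so that the dispatch to
  \<open>padd_cases\<close> decreases the measure as well.\<close>

termination by (relation "Wellfounded.measure (\<lambda>z. case z of
    Inl (p, q) \<Rightarrow> 2 * (size p + size q)
  | Inr (c, x, p, q, y, r, s) \<Rightarrow> 2 * (size (Hor x p q) + size (Hor y r s)) - 1)") auto

fun pscale :: "int \<Rightarrow> dpoly \<Rightarrow> dpoly" where
  "pscale c (Cst a) = Cst (c * a)"
| "pscale c (Hor x p q) = Hor x (pscale c p) (pscale c q)"

fun pscale_cases :: "bool \<Rightarrow> bool \<Rightarrow> int \<Rightarrow> dpoly \<Rightarrow> dpoly" where
  "pscale_cases True b c q = Cst 0"
| "pscale_cases False True c q = q"
| "pscale_cases False False c q = pscale c q"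

function (sequential) pmul :: "dpoly \<Rightarrow> dpoly \<Rightarrow> dpoly"
  and pmul_cases :: "comp \<Rightarrow> jvar \<Rightarrow> dpoly \<Rightarrow> dpoly \<Rightarrow> jvar \<Rightarrow> dpoly \<Rightarrow> dpoly \<Rightarrow> dpoly" where
  "pmul (Cst a) q = pscale_cases (a = 0) (a = 1) a q"
| "pmul (Hor x p q) (Cst b) = pscale_cases (b = 0) (b = 1) b (Hor x p q)"
| "pmul (Hor x p q) (Hor y r s) = pmul_cases (jcomp x y) x p q y r s"
| "pmul_cases Lt x p q y r s = hor x (pmul p (Hor y r s)) (pmul q (Hor y r s))"
| "pmul_cases Eq x p q y r s = hor x (padd (pmul p (Hor y r s)) (pmul q r)) (pmul q s)"
| "pmul_cases Gt x p q y r s = hor y (pmul (Hor x p q) r) (pmul (Hor x p q) s)"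
  by pat_completeness auto
termination by (relation "Wellfounded.measure (\<lambda>z. case z of
    Inl (p, q) \<Rightarrow> 2 * (size p + size q)
  | Inr (c, x, p, q, y, r, s) \<Rightarrow> 2 * (size (Hor x p q) + size (Hor y r s)) - 1)") auto

instantiation dpoly :: "{plus, minus, times}"
begin
definition plus_dpoly :: "dpoly \<Rightarrow> dpoly \<Rightarrow> dpoly" where "plus_dpoly = padd"
definition minus_dpoly :: "dpoly \<Rightarrow> dpoly \<Rightarrow> dpoly" where "minus_dpoly p q = padd p (pscale (-1) q)"
definition times_dpoly :: "dpoly \<Rightarrow> dpoly \<Rightarrow> dpoly" where "times_dpoly = pmul"
instance ..
end

definition pvar :: "jvar \<Rightarrow> dpoly" where
  "pvar x = Hor x (Cst 1) (Cst 0)"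

abbreviation jet :: "nat \<Rightarrow> nat \<Rightarrow> nat \<Rightarrow> dpoly" where
  "jet f a b \<equiv> pvar (Jet f a b)"

type_synonym idx = "2 + 2"

text \<open>The total derivative of a generator of jet space. Mixed derivatives commute here by
  construction; \<open>partial_2_pd\<close> is the analytic counterpart.\<close>

definition jder :: "idx \<Rightarrow> jvar \<Rightarrow> dpoly" where
  "jder i v = (case v of
      Y1 \<Rightarrow> Cst (if i = Inr 1 then 1 else 0)
    | Y2 \<Rightarrow> Cst (if i = Inr 2 then 1 else 0)
    | Jet f a b \<Rightarrow> (case i of
        Inl k \<Rightarrow> if k = 1 then jet f (Suc a) b else jet f a (Suc b)
      | Inr k \<Rightarrow> Cst 0))"

lemma jder_simps:
  "jder (Inl i) Y1 = Cst 0" "jder (Inl i) Y2 = Cst 0"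
  "jder (Inl 1) (Jet f a b) = jet f (Suc a) b" "jder (Inl 2) (Jet f a b) = jet f a (Suc b)"
  "jder (Inr 1) Y1 = Cst 1" "jder (Inr 2) Y1 = Cst 0"
  "jder (Inr 1) Y2 = Cst 0" "jder (Inr 2) Y2 = Cst 1"
  "jder (Inr i) (Jet f a b) = Cst 0"
  by (simp_all add: jder_def)

fun pder :: "idx \<Rightarrow> dpoly \<Rightarrow> dpoly" where
  "pder i (Cst c) = Cst 0"
| "pder i (Hor x p q) = jder i x * p + pvar x * pder i p + pder i q"

definition psum :: "(idx \<Rightarrow> dpoly) \<Rightarrow> dpoly" where
  "psum f = f (Inl 1) + f (Inl 2) + f (Inr 1) + f (Inr 2)"

definition psum2 :: "(2 \<Rightarrow> dpoly) \<Rightarrow> dpoly" where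
  "psum2 f = f 1 + f 2"

text \<open>
  Tables of components, in the order \<open>x\<^sup>1, x\<^sup>2, y\<^sub>1, y\<^sub>2\<close>. Passing them as arguments makes the simplifier
  compute every component once.
\<close>

datatype 'a quad = Quad 'a 'a 'a 'a

definition entry :: "'a quad \<Rightarrow> idx \<Rightarrow> 'a" where
  "entry t i = (case t of Quad a b c d \<Rightarrow>
     (case i of Inl k \<Rightarrow> if k = 1 then a else b | Inr k \<Rightarrow> if k = 1 then c else d))"

lemma entry_simps:
  "entry (Quad a b c d) (Inl 1) = a" "entry (Quad a b c d) (Inl 2) = b"
  "entry (Quad a b c d) (Inr 1) = c" "entry (Quad a b c d) (Inr 2) = d"
  by (simp_all add: entry_def)

definition tab :: "(idx \<Rightarrow> 'a) \<Rightarrow> 'a quad" where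
  "tab f = Quad (f (Inl 1)) (f (Inl 2)) (f (Inr 1)) (f (Inr 2))"
definition tab2 :: "(idx \<Rightarrow> idx \<Rightarrow> 'a) \<Rightarrow> 'a quad quad" where
  "tab2 f = Quad (tab (f (Inl 1))) (tab (f (Inl 2))) (tab (f (Inr 1))) (tab (f (Inr 2)))"
definition tab3 :: "(idx \<Rightarrow> idx \<Rightarrow> idx \<Rightarrow> 'a) \<Rightarrow> 'a quad quad quad" where
  "tab3 f = Quad (tab2 (f (Inl 1))) (tab2 (f (Inl 2))) (tab2 (f (Inr 1))) (tab2 (f (Inr 2)))"
definition tab4 :: "(idx \<Rightarrow> idx \<Rightarrow> idx \<Rightarrow> idx \<Rightarrow> 'a) \<Rightarrow> 'a quad quad quad quad" where
  "tab4 f = Quad (tab3 (f (Inl 1))) (tab3 (f (Inl 2))) (tab3 (f (Inr 1))) (tab3 (f (Inr 2)))"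

definition "entry2 t i j = entry (entry t i) j"
definition "entry3 t i j k = entry (entry2 t i j) k"
definition "entry4 t i j k l = entry (entry3 t i j k) l"

text \<open>
  In the following the argument \<open>g\<close> is a metric of the form \<open>2 dx\<^sup>i dy\<^sub>i + g\<^sub>i\<^sub>j dx\<^sup>i dx\<^sup>j\<close>, whose inverse has
  the blocks \<open>0\<close>, \<open>1\<close>, \<open>1\<close> and \<open>- g\<^sub>i\<^sub>j\<close>.
\<close>

fun praise :: "(idx \<Rightarrow> idx \<Rightarrow> dpoly) \<Rightarrow> (idx \<Rightarrow> dpoly) \<Rightarrow> idx \<Rightarrow> dpoly" where
  "praise g A (Inl i) = A (Inr i)"
| "praise g A (Inr i) = A (Inl i) - psum2 (\<lambda>j. g (Inl i) (Inl j) * A (Inr j))"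

fun plower :: "(idx \<Rightarrow> idx \<Rightarrow> dpoly) \<Rightarrow> (idx \<Rightarrow> dpoly) \<Rightarrow> idx \<Rightarrow> dpoly" where
  "plower g A (Inl i) = A (Inr i) + psum2 (\<lambda>j. A (Inl j) * g (Inl j) (Inl i))"
| "plower g A (Inr i) = A (Inl i)"

definition pcontr :: "(idx \<Rightarrow> idx \<Rightarrow> dpoly) \<Rightarrow> (idx \<Rightarrow> idx \<Rightarrow> dpoly) \<Rightarrow> dpoly" where
  "pcontr g A = psum2 (\<lambda>i. A (Inl i) (Inr i) + A (Inr i) (Inl i))
     - psum2 (\<lambda>i. psum2 (\<lambda>j. g (Inl i) (Inl j) * A (Inr i) (Inr j)))"

fun pinv :: "(idx \<Rightarrow> idx \<Rightarrow> dpoly) \<Rightarrow> idx \<Rightarrow> idx \<Rightarrow> dpoly" where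
  "pinv g (Inl i) (Inl j) = Cst 0"
| "pinv g (Inl i) (Inr j) = Cst (if i = j then 1 else 0)"
| "pinv g (Inr i) (Inl j) = Cst (if i = j then 1 else 0)"
| "pinv g (Inr i) (Inr j) = Cst (-1) * g (Inl i) (Inl j)"

text \<open>
  To stay with integer coefficients the geometric objects are scaled: \<open>pLC\<close> is twice the Christoffel
  symbols, the covariant derivatives carry a factor 2, \<open>pRop\<close> and \<open>pRic\<close> are 4 times the curvature and
  the Ricci tensor, \<open>pWeyl\<close> is 8 times the Weyl tensor, \<open>pDiv\<close> is 16 times its divergence and \<open>pBach\<close> is
  64 times the Bach tensor. The term with the scalar curvature is missing in \<open>pWeyl\<close>, as the scalar
  curvature vanishes.
\<close>

definition pdG :: "(idx \<Rightarrow> idx \<Rightarrow> dpoly) \<Rightarrow> idx \<Rightarrow> idx \<Rightarrow> idx \<Rightarrow> dpoly" where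
  "pdG g i j k = pder i (g j k)"

definition pLC :: "(idx \<Rightarrow> idx \<Rightarrow> dpoly) \<Rightarrow> (idx \<Rightarrow> idx \<Rightarrow> idx \<Rightarrow> dpoly) \<Rightarrow>
    idx \<Rightarrow> idx \<Rightarrow> idx \<Rightarrow> dpoly" where
  "pLC g d i j k = praise g (\<lambda>l. d i j l + d j i l - d l i j) k"

text \<open>Twice the covariant derivative of the contravariant tensor \<open>h\<close>, as
  \<open>L\<close> holds doubled Christoffel symbols.\<close>

definition pPar :: "(idx \<Rightarrow> idx \<Rightarrow> dpoly) \<Rightarrow> (idx \<Rightarrow> idx \<Rightarrow> idx \<Rightarrow> dpoly) \<Rightarrow>
    idx \<Rightarrow> idx \<Rightarrow> idx \<Rightarrow> dpoly" where
  "pPar h L a i j = Cst 2 * pder a (h i j) + psum (\<lambda>m. L a m i * h m j + L a m j * h i m)"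

definition pRop :: "(idx \<Rightarrow> idx \<Rightarrow> idx \<Rightarrow> dpoly) \<Rightarrow> idx \<Rightarrow> idx \<Rightarrow> idx \<Rightarrow> idx \<Rightarrow> dpoly" where
  "pRop L i j k l = Cst 2 * (pder i (L j k l) - pder j (L i k l))
     + psum (\<lambda>m. L j k m * L i m l - L i k m * L j m l)"

definition pRic :: "(idx \<Rightarrow> idx \<Rightarrow> idx \<Rightarrow> idx \<Rightarrow> dpoly) \<Rightarrow> idx \<Rightarrow> idx \<Rightarrow> dpoly" where
  "pRic R j k = psum (\<lambda>i. R i j k i)"

definition pWeyl :: "(idx \<Rightarrow> idx \<Rightarrow> dpoly) \<Rightarrow> (idx \<Rightarrow> idx \<Rightarrow> idx \<Rightarrow> idx \<Rightarrow> dpoly) \<Rightarrow>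
    (idx \<Rightarrow> idx \<Rightarrow> dpoly) \<Rightarrow> idx \<Rightarrow> idx \<Rightarrow> idx \<Rightarrow> idx \<Rightarrow> dpoly" where
  "pWeyl g R \<rho> i j k l = Cst 2 * plower g (R i j k) l
     - (\<rho> j k * g i l - \<rho> i k * g j l + g j k * \<rho> i l - g i k * \<rho> j l)"

definition pnabla3 :: "(idx \<Rightarrow> idx \<Rightarrow> idx \<Rightarrow> dpoly) \<Rightarrow> (idx \<Rightarrow> idx \<Rightarrow> idx \<Rightarrow> dpoly) \<Rightarrow>
    idx \<Rightarrow> idx \<Rightarrow> idx \<Rightarrow> idx \<Rightarrow> dpoly" where
  "pnabla3 L A m i j k = Cst 2 * pder m (A i j k)
     - psum (\<lambda>l. L m i l * A l j k + L m j l * A i l k + L m k l * A i j l)"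

definition pnabla4 :: "(idx \<Rightarrow> idx \<Rightarrow> idx \<Rightarrow> dpoly) \<Rightarrow> (idx \<Rightarrow> idx \<Rightarrow> idx \<Rightarrow> idx \<Rightarrow> dpoly) \<Rightarrow>
    idx \<Rightarrow> idx \<Rightarrow> idx \<Rightarrow> idx \<Rightarrow> idx \<Rightarrow> dpoly" where
  "pnabla4 L A m i j k n = Cst 2 * pder m (A i j k n)
     - psum (\<lambda>l. L m i l * A l j k n + L m j l * A i l k n + L m k l * A i j l n + L m n l * A i j k l)"

definition pDiv :: "(idx \<Rightarrow> idx \<Rightarrow> dpoly) \<Rightarrow> (idx \<Rightarrow> idx \<Rightarrow> idx \<Rightarrow> dpoly) \<Rightarrow>
    (idx \<Rightarrow> idx \<Rightarrow> idx \<Rightarrow> idx \<Rightarrow> dpoly) \<Rightarrow> idx \<Rightarrow> idx \<Rightarrow> idx \<Rightarrow> dpoly" where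
  "pDiv g L W k i j = pcontr g (\<lambda>l b. pnabla4 L W b k i j l)"

definition pBach :: "(idx \<Rightarrow> idx \<Rightarrow> dpoly) \<Rightarrow> (idx \<Rightarrow> idx \<Rightarrow> idx \<Rightarrow> dpoly) \<Rightarrow>
    (idx \<Rightarrow> idx \<Rightarrow> dpoly) \<Rightarrow> (idx \<Rightarrow> idx \<Rightarrow> idx \<Rightarrow> idx \<Rightarrow> dpoly) \<Rightarrow>
    (idx \<Rightarrow> idx \<Rightarrow> idx \<Rightarrow> dpoly) \<Rightarrow> idx \<Rightarrow> idx \<Rightarrow> dpoly" where
  "pBach g L \<rho> W C i j = Cst 2 * pcontr g (\<lambda>k a. pnabla3 L C a k i j)
     + pcontr g (\<lambda>k a. pcontr g (\<lambda>l b. \<rho> a b * W k i j l))"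

text \<open>
  The functions \<open>\<alpha>\<close>, \<open>\<xi>\<close>, \<open>\<Gamma>\<^sub>1\<^sub>1\<^sup>1\<close>, \<open>\<Gamma>\<^sub>1\<^sub>1\<^sup>2\<close>, \<open>\<Gamma>\<^sub>1\<^sub>2\<^sup>1\<close>, \<open>\<Gamma>\<^sub>1\<^sub>2\<^sup>2\<close>, \<open>\<Gamma>\<^sub>2\<^sub>2\<^sup>1\<close>, \<open>\<Gamma>\<^sub>2\<^sub>2\<^sup>2\<close>, \<open>\<Phi>\<^sub>1\<^sub>1\<close>, \<open>\<Phi>\<^sub>1\<^sub>2\<close>, \<open>\<Phi>\<^sub>2\<^sub>2\<close>
  are numbered from 0 to 10.
\<close>

abbreviation "pA \<equiv> jet 0 0 0"
abbreviation "pX \<equiv> jet 1 0 0"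

text \<open>For the given \<open>T\<close> the covector with components \<open>y_r T^r_i\<close> is
  \<open>ptau\<close> times \<open>(\<xi>, 1)\<close>. The quadratic part of the metric is its
  square, so the factor \<open>s\<close> in \<open>pxx\<close> is \<open>\<xi>^2\<close>,
  \<open>\<xi>\<close> or 1.\<close>

definition ptau :: dpoly where
  "ptau = pA * (pvar Y1 - pX * pvar Y2)"

definition pxx :: "dpoly \<Rightarrow> nat \<Rightarrow> nat \<Rightarrow> nat \<Rightarrow> dpoly" where
  "pxx s m n f = ptau * ptau * s - Cst 2 * (pvar Y1 * jet m 0 0 + pvar Y2 * jet n 0 0) + jet f 0 0"

definition metric_tab :: "dpoly quad quad" where
  "metric_tab = Quad
    (Quad (pxx (pX * pX) 2 3 8) (pxx pX 4 5 9) (Cst 1) (Cst 0))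
    (Quad (pxx pX 4 5 9) (pxx (Cst 1) 6 7 10) (Cst 0) (Cst 1))
    (Quad (Cst 1) (Cst 0) (Cst 0) (Cst 0))
    (Quad (Cst 0) (Cst 1) (Cst 0) (Cst 0))"

definition pP1 :: dpoly where
  "pP1 = pX * jet 1 0 1 - jet 1 1 0 + jet 6 0 0 * pX * pX * pX
     - (Cst 2 * jet 4 0 0 - jet 7 0 0) * pX * pX + (jet 2 0 0 - Cst 2 * jet 5 0 0) * pX + jet 3 0 0"

definition pP2 :: dpoly where
  "pP2 = (let
       u = pX; a = pA; a1 = jet 0 1 0; a2 = jet 0 0 1; u2 = jet 1 0 1;
       G111 = jet 2 0 0; G112 = jet 3 0 0; G121 = jet 4 0 0;
       G122 = jet 5 0 0; G221 = jet 6 0 0; G222 = jet 7 0 0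
     in
       a * jet 0 2 0 + u * u * a * jet 0 0 2 - Cst 2 * u * a * jet 0 1 1
       + a1 * a1 + u * u * a2 * a2 - Cst 2 * u * a1 * a2
       - a * a1 *
           (Cst 2 * u2 - Cst 5 * G221 * u * u + Cst 2 * (Cst 4 * G121 - G222) * u - Cst 3 * G111 + Cst 2 * G122)
       + a * a2 *
           (Cst 2 * u * u2 - Cst 6 * G221 * u * u * u + (Cst 10 * G121 - Cst 3 * G222) * u * u
            - Cst 4 * (G111 - G122) * u - G112)
       + Cst 6 * u * u * u * u * a * a * G221 * G221
       - Cst 2 * u * u * u * a * a * (jet 6 0 1 + Cst 9 * G121 * G221 - Cst 3 * G221 * G222)
       - u * u * a * a *
           (Cst 4 * G221 * u2 - Cst 3 * jet 4 0 1 - Cst 2 * jet 6 1 0 + jet 7 0 1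
            - Cst 12 * G121 * G121 - G222 * G222 - Cst 7 * G111 * G221 + Cst 7 * G121 * G222 + Cst 9 * G122 * G221)
       + u * a * a *
           (Cst 2 * (Cst 3 * G121 - G222) * u2 - jet 2 0 1 - Cst 3 * jet 4 1 0
            + jet 5 0 1 + jet 7 1 0
            - Cst 2 * (G111 - G122) * (Cst 4 * G121 - G222) + Cst 4 * G112 * G221)
       - a * a *
           (Cst 2 * (G111 - G122) * u2 - jet 2 1 0 + jet 5 1 0
            - G111 * G111 + G111 * G122 + Cst 3 * G112 * G121 - G112 * G222))"

text \<open>
  64 times the remainders \<open>E\<^sub>1\<^sub>2\<close> and \<open>E\<^sub>2\<^sub>2\<close>: what is left when \<open>\<partial>\<^sub>1\<xi>\<close> and its derivatives are eliminated in
  favour of \<open>P1\<close>.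
\<close>

definition pE12 :: dpoly where
  "pE12 = Cst 64 * ((Cst 8 * pA * (jet 0 1 0 - pX * jet 0 0 1)
       + pA * pA * (Cst 4 * jet 2 0 0 - Cst 8 * pX * jet 4 0 0 + Cst 4 * pX * pX * jet 6 0 0 - Cst 6 * jet 1 0 1)) * pP1
     + Cst 2 * pA * pA * (pder (Inl 1) pP1 - pX * pder (Inl 2) pP1))"

definition pE22 :: dpoly where
  "pE22 = Cst 64 * ((pA * pA * (Cst 20 * pX * jet 6 0 0 - Cst 16 * jet 4 0 0 + Cst 4 * jet 7 0 0)
       - Cst 8 * pA * jet 0 0 1) * pP1
     - Cst 4 * pA * pA * pder (Inl 2) pP1)"

text \<open>Every entry is to vanish. The entries encode the three identities for the base
  components multiplied by 64 (whence 256 = 4 * 64), the symmetry of the base block, and the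
  vanishing of all components with a fibre index.\<close>

definition bach_defects :: "(idx \<Rightarrow> idx \<Rightarrow> dpoly) \<Rightarrow> dpoly quad quad" where
  "bach_defects B = Quad
    (Quad (B (Inl 1) (Inl 1) - Cst 2 * pX * B (Inl 1) (Inl 2) + pX * pX * B (Inl 2) (Inl 2)
             + Cst 256 * pA * pA * pP1 * pP1)
          (B (Inl 1) (Inl 2) - pX * B (Inl 2) (Inl 2) - pE12)
          (B (Inl 1) (Inr 1)) (B (Inl 1) (Inr 2)))
    (Quad (B (Inl 2) (Inl 1) - B (Inl 1) (Inl 2))
          (B (Inl 2) (Inl 2) + Cst 256 * pP2 - pE22)
          (B (Inl 2) (Inr 1)) (B (Inl 2) (Inr 2)))
    (tab (B (Inr 1)))
    (tab (B (Inr 2)))"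

definition "check_tab t \<longleftrightarrow> pred_quad (pred_quad (\<lambda>p. p = Cst 0)) t"

text \<open>Here \<open>s\<close> is 4 times the scalar curvature; its vanishing justifies the term
  left out of \<open>pWeyl\<close>.\<close>

definition "check_bach s B \<longleftrightarrow> s = Cst 0 \<and> check_tab (bach_defects (entry2 B))"
text \<open>From here to \<open>bach_check\<close> each stage hands its new table to the next one as
  an argument, so that the table is normalised before the next stage unfolds.\<close>

definition "with_div G L r W C =
  check_bach (pcontr (entry2 G) (entry2 r)) (tab2 (pBach (entry2 G) (entry3 L) (entry2 r) (entry4 W) (entry3 C)))"
definition "with_weyl G L r W =
  with_div G L r W (tab3 (pDiv (entry2 G) (entry3 L) (entry4 W)))"
definition "with_ricci G L R r =
  with_weyl G L r (tab4 (pWeyl (entry2 G) (entry4 R) (entry2 r)))"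
definition "with_curvature G L R = with_ricci G L R (tab2 (pRic (entry4 R)))"
definition "with_LC G L = with_curvature G L (tab4 (pRop (entry3 L)))"
definition "with_derivatives G d = with_LC G (tab3 (pLC (entry2 G) (entry3 d)))"
definition "bach_check G = with_derivatives G (tab3 (pdG (entry2 G)))"

definition "check_parallel L h \<longleftrightarrow> pred_quad check_tab (tab3 (pPar (entry2 h) (entry3 L)))"
definition "parallel_with_LC G L = check_parallel L (tab2 (pinv (entry2 G)))"
definition "parallel_with_derivatives G d = parallel_with_LC G (tab3 (pLC (entry2 G) (entry3 d)))"
definition "parallel_check G = parallel_with_derivatives G (tab3 (pdG (entry2 G)))"

section \<open>Symbolic evaluation by rewriting\<close>

lemmas poly_eval = jcomp.simps ncomp.simps hor_cases.simps hor.simps padd.simps padd_cases.simps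
  pscale.simps pscale_cases.simps pmul.simps pmul_cases.simps plus_dpoly_def minus_dpoly_def times_dpoly_def
  pder.simps jder_simps pvar_def simp_thms
  arith_simps rel_simps arith_special mult_1_left mult_1_right mult_minus1 mult_minus1_right minus_minus
  inc.simps eval_nat_numeral One_nat_def

lemmas expand = psum_def psum2_def praise.simps plower.simps pcontr_def
  plus_dpoly_def minus_dpoly_def times_dpoly_def

lemma delta_2: "((1::2) = 2) = False" "((2::2) = 1) = False" by simp_all

text \<open>
  The sums are expanded before the evaluation: a table inside an abstraction would be normalised again
  with every expansion.
\<close>

lemmas geometry_eval = pdG_def
  pLC_def[of _ _ _ _ "Inl _", unfolded expand] pLC_def[of _ _ _ _ "Inr _", unfolded expand]
  pRop_def[unfolded expand] pRic_def[unfolded expand]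
  pWeyl_def[of _ _ _ _ _ _ "Inl _", unfolded expand] pWeyl_def[of _ _ _ _ _ _ "Inr _", unfolded expand]
  pnabla3_def[unfolded expand] pnabla4_def[unfolded expand] pDiv_def[unfolded expand] pBach_def[unfolded expand]
  pcontr_def[unfolded psum2_def plus_dpoly_def minus_dpoly_def times_dpoly_def]
  pPar_def[unfolded expand] pinv.simps[unfolded expand] delta_2 if_True if_False

lemmas table_eval = entry_simps entry2_def entry3_def entry4_def tab_def tab2_def tab3_def tab4_def
  metric_tab_def pxx_def ptau_def check_tab_def quad.pred_inject

lemmas stage_eval = bach_check_def with_derivatives_def with_LC_def with_curvature_def with_ricci_def
  with_weyl_def with_div_def check_bach_def bach_defects_def pE12_def pE22_def pP1_def pP2_def Let_def
  parallel_check_def parallel_with_derivatives_def parallel_with_LC_def check_parallel_def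

lemma parallel_check: "parallel_check metric_tab"
  by (simp only: poly_eval geometry_eval table_eval stage_eval)

text \<open>The computational core: rewriting reduces the scalar curvature and every Bach defect to
  the literal zero polynomial.\<close>

lemma bach_check: "bach_check metric_tab"
  by (simp only: poly_eval geometry_eval table_eval stage_eval)

section \<open>Evaluation\<close>

fun peval :: "(jvar \<Rightarrow> real) \<Rightarrow> dpoly \<Rightarrow> real" where
  "peval v (Cst c) = of_int c"
| "peval v (Hor x p q) = v x * peval v p + peval v q"

section \<open>Soundness of the polynomial arithmetic\<close>

lemma ncomp_Eq: "ncomp m n c = Eq \<longleftrightarrow> m = n \<and> c = Eq"
  by (induction m n c rule: ncomp.induct) auto

lemma jcomp_Eq: "jcomp x y = Eq \<Longrightarrow> x = y"
  by (cases "(x, y)" rule: jcomp.cases) (auto simp: ncomp_Eq)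

lemma peval_hor [simp]: "peval v (hor x p q) = v x * peval v p + peval v q"
proof (cases p)
  case (Cst c)
  then show ?thesis by (cases "c = 0") auto
qed auto

text \<open>The \<open>Eq\<close> branch merges the coefficients of \<open>x\<close> and
  \<open>y\<close>, hence the side condition; \<open>jcomp_Eq\<close> supplies it in the
  recursion.\<close>

lemma peval_padd [simp]: "peval v (padd p q) = peval v p + peval v q"
  and peval_padd_cases: "(c = Eq \<longrightarrow> x = y) \<Longrightarrow>
    peval v (padd_cases c x p' q' y r s) = v x * peval v p' + peval v q' + (v y * peval v r + peval v s)"
  by (induction p q and c x p' q' y r s rule: padd_padd_cases.induct)
    (auto simp: jcomp_Eq algebra_simps)

lemma peval_pscale [simp]: "peval v (pscale c p) = of_int c * peval v p"
  by (induction p) (auto simp: algebra_simps)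

lemma peval_pscale_cases [simp]: "peval v (pscale_cases (c = 0) (c = 1) c p) = of_int c * peval v p"
  by (cases "c = 0"; cases "c = 1") auto

lemma peval_pmul [simp]: "peval v (pmul p q) = peval v p * peval v q"
  and peval_pmul_cases: "(c = Eq \<longrightarrow> x = y) \<Longrightarrow>
    peval v (pmul_cases c x p' q' y r s) = (v x * peval v p' + peval v q') * (v y * peval v r + peval v s)"
  by (induction p q and c x p' q' y r s rule: pmul_pmul_cases.induct)
    (auto simp: jcomp_Eq algebra_simps)

lemma peval_plus [simp]: "peval v (p + q) = peval v p + peval v q"
  by (simp add: plus_dpoly_def)

lemma peval_minus [simp]: "peval v (p - q) = peval v p - peval v q"
  by (simp add: minus_dpoly_def)

lemma peval_times [simp]: "peval v (p * q) = peval v p * peval v q"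
  by (simp add: times_dpoly_def)

lemma peval_pvar [simp]: "peval v (pvar x) = v x"
  by (simp add: pvar_def)

lemma peval_psum2 [simp]: "peval v (psum2 f) = (\<Sum>i\<in>UNIV. peval v (f i))"
  by (simp add: psum2_def sum_2)

lemma peval_psum [simp]: "peval v (psum f) = (\<Sum>i\<in>UNIV. peval v (f i))"
  by (simp add: psum_def sum_UNIV_sum_type sum_2)

section \<open>Tables as functions of their indices\<close>

lemma idx_cases [case_names x1 x2 y1 y2]:
  fixes i :: idx
  obtains "i = Inl 1" | "i = Inl 2" | "i = Inr 1" | "i = Inr 2"
  using exhaust_2 by (cases i) (metis)+

lemma entry_tab [simp]: "entry (tab f) i = f i"
  by (cases i rule: idx_cases) (simp_all add: tab_def entry_simps)

lemma entry_tab2 [simp]: "entry2 (tab2 f) = f"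
proof -
  have "tab2 f = tab (\<lambda>i. tab (f i))"
    by (simp add: tab2_def tab_def)
  then show ?thesis
    by (simp add: entry2_def fun_eq_iff)
qed

lemma entry_tab3 [simp]: "entry3 (tab3 f) = f"
proof -
  have "tab3 f = tab (\<lambda>i. tab2 (f i))"
    by (simp add: tab3_def tab_def)
  then show ?thesis
    by (simp add: entry3_def entry2_def fun_eq_iff) (simp add: entry2_def[symmetric])
qed

lemma entry_tab4 [simp]: "entry4 (tab4 f) = f"
proof -
  have "tab4 f = tab (\<lambda>i. tab3 (f i))"
    by (simp add: tab4_def tab_def)
  then show ?thesis
    by (simp add: entry4_def entry3_def entry2_def fun_eq_iff)
      (simp add: entry2_def[symmetric] entry3_def[symmetric])
qed

lemma pred_quad_entry: "pred_quad P q \<longleftrightarrow> (\<forall>i. P (entry q i))"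
  by (cases q) (simp add: split_sum_all forall_2 entry_simps)

lemma check_tab_entry: "check_tab t \<longleftrightarrow> (\<forall>i j. entry2 t i j = Cst 0)"
  by (simp add: check_tab_def entry2_def pred_quad_entry)

section \<open>Jets as functions on the cotangent bundle\<close>

definition jval :: "(nat \<Rightarrow> real^2 \<Rightarrow> real) \<Rightarrow> real^idx \<Rightarrow> jvar \<Rightarrow> real" where
  "jval F p x = (case x of Y1 \<Rightarrow> p $ Inr 1 | Y2 \<Rightarrow> p $ Inr 2 | Jet f a b \<Rightarrow> pd a b (F f) (base_pt p))"

lemma linear_base_pt: "linear base_pt"
  by (intro linearI) (simp_all add: base_pt_def vec_eq_iff)

lemma open_cotangent_bundle: "open U \<Longrightarrow> open (cotangent_bundle U)"
proof -
  assume "open U"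
  then have "open (base_pt -` U)"
    using linear_base_pt by (intro open_vimage) (auto simp: linear_continuous_on linear_conv_bounded_linear)
  moreover have "base_pt -` U = cotangent_bundle U"
    by (auto simp: cotangent_bundle_def)
  ultimately show ?thesis by simp
qed

lemma partial_nth: "partial i (\<lambda>z. z $ k) p = (if i = k then 1 else 0)"
proof -
  have "((\<lambda>z. z $ k) has_derivative (\<lambda>z. z $ k)) (at p)"
    by (rule bounded_linear_imp_has_derivative[OF bounded_linear_vec_nth])
  then show ?thesis
    by (auto simp: partial_eq_derivative axis_def)
qed

lemma partial_base_pt:
  "partial (Inl k) (\<lambda>z. f (base_pt z)) p = partial k f (base_pt p)"
  "partial (Inr l) (\<lambda>z. f (base_pt z)) p = 0"
proof -
  have "base_pt (p + t *\<^sub>R axis (Inl k) 1) = base_pt p + t *\<^sub>R axis k 1" for t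
    by (simp add: base_pt_def vec_eq_iff axis_def)
  then show "partial (Inl k) (\<lambda>z. f (base_pt z)) p = partial k f (base_pt p)"
    by (simp add: partial_def)
  have "base_pt (p + t *\<^sub>R axis (Inr l) 1) = base_pt p" for t
    by (simp add: base_pt_def vec_eq_iff axis_def)
  then show "partial (Inr l) (\<lambda>z. f (base_pt z)) p = 0"
    by (simp add: partial_def)
qed

lemma differentiable_base_pt:
  assumes "f differentiable at (base_pt p)"
  shows "(\<lambda>z. f (base_pt z)) differentiable at p"
  using differentiable_chain_at[of base_pt p f] assms linear_base_pt
  by (simp add: o_def linear_imp_differentiable)

lemma jval_differentiable:
  assumes "open U" "\<And>n. smooth_on U (F n)" "p \<in> cotangent_bundle U"
  shows "(\<lambda>z. jval F z x) differentiable at p"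
proof (cases x)
  case (Jet f a b)
  have "pd a b (F f) differentiable at (base_pt p)"
    using assms smooth_on_differentiable smooth_on_pd by (metis cotangent_bundle_def mem_Collect_eq)
  then show ?thesis
    using differentiable_base_pt by (simp add: jval_def Jet)
qed (simp_all add: jval_def bounded_linear_imp_differentiable bounded_linear_vec_nth)

lemma partial_jval:
  assumes "open U" "\<And>n. smooth_on U (F n)" "p \<in> cotangent_bundle U"
  shows "partial i (\<lambda>z. jval F z x) p = peval (jval F p) (jder i x)"
proof (cases x)
  case (Jet f a b)
  then have eq: "(\<lambda>z. jval F z x) = (\<lambda>z. pd a b (F f) (base_pt z))"
    by (simp add: jval_def)
  have "base_pt p \<in> U"
    using assms(3) by (simp add: cotangent_bundle_def)
  then show ?thesis
    unfolding eq Jet by (cases i rule: idx_cases)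
      (simp_all add: partial_base_pt jder_simps jval_def partial_1_pd partial_2_pd[OF assms(1) _ assms(2)])
qed (simp_all add: jval_def jder_def partial_nth)

text \<open>Formal and actual derivatives agree on generators, and both obey the Leibniz rule.
  Differentiability belongs to the same induction because the product rule requires it.\<close>

lemma peval_differentiable_partial:
  assumes "open U" "\<And>n. smooth_on U (F n)" "p \<in> cotangent_bundle U"
  shows "(\<lambda>z. peval (jval F z) P) differentiable at p \<and>
    partial i (\<lambda>z. peval (jval F z) P) p = peval (jval F p) (pder i P)"
proof (induction P)
  case (Cst c)
  then show ?case by (simp add: partial_const)
next
  case (Hor x P Q)
  note d = jval_differentiable[OF assms]
  show ?case
    using Hor d by (simp add: partial_add partial_mult differentiable_mult partial_jval[OF assms])
qed

section \<open>The Bach tensor of the extension\<close>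

text \<open>Numbers beyond 10 default to \<alpha>, so that \<open>F n\<close> is smooth for every
  \<open>n\<close>.\<close>

definition fields :: "2 connection \<Rightarrow> (real^2 \<Rightarrow> real^2^2) \<Rightarrow> (real^2 \<Rightarrow> real) \<Rightarrow> (real^2 \<Rightarrow> real) \<Rightarrow>
    nat \<Rightarrow> real^2 \<Rightarrow> real" where
  "fields \<Gamma> \<Phi> \<alpha> \<xi> n x =
    (if n < 11 then [\<alpha> x, \<xi> x, \<Gamma> x 1 1 1, \<Gamma> x 1 1 2, \<Gamma> x 1 2 1, \<Gamma> x 1 2 2, \<Gamma> x 2 2 1, \<Gamma> x 2 2 2,
      \<Phi> x $ 1 $ 1, \<Phi> x $ 1 $ 2, \<Phi> x $ 2 $ 2] ! n else \<alpha> x)"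

locale nilpotent_extension =
  fixes U :: "(real^2) set"
    and \<Gamma> :: "2 connection"
    and T \<Phi> :: "real^2 \<Rightarrow> real^2^2"
    and \<alpha> \<xi> :: "real^2 \<Rightarrow> real"
  assumes surface: "affine_surface U \<Gamma>"
    and smooth: "smooth_on U \<alpha>" "smooth_on U \<xi>"
    and T: "\<forall>x\<in>U. T x = \<alpha> x *\<^sub>R vector [vector [\<xi> x, 1], vector [- (\<xi> x)\<^sup>2, - \<xi> x]]"
    and \<Phi>: "smooth_sym_2tensor U \<Phi>"
begin

abbreviation "S \<equiv> cotangent_bundle U"
abbreviation "F \<equiv> fields \<Gamma> \<Phi> \<alpha> \<xi>"
abbreviation "ev p P \<equiv> peval (jval F p) P"
abbreviation "g \<equiv> riemannian_extension T \<Gamma> \<Phi>"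
abbreviation "LC \<equiv> levi_civita g"

abbreviation "G \<equiv> entry2 metric_tab"
abbreviation "L \<equiv> pLC G (pdG G)"
abbreviation "R \<equiv> pRop L"
abbreviation "r \<equiv> pRic R"
abbreviation "W \<equiv> pWeyl G R r"
abbreviation "C \<equiv> pDiv G L W"
abbreviation "B \<equiv> pBach G L r W C"

lemma open_U: "open U"
  using surface by (simp add: affine_surface_def)

lemma open_S: "open S"
  by (rule open_cotangent_bundle[OF open_U])

lemma smooth_F: "smooth_on U (F n)"
proof -
  have eq: "F n = (if n < 11 then [\<alpha>, \<xi>, \<lambda>x. \<Gamma> x 1 1 1, \<lambda>x. \<Gamma> x 1 1 2, \<lambda>x. \<Gamma> x 1 2 1, \<lambda>x. \<Gamma> x 1 2 2,
      \<lambda>x. \<Gamma> x 2 2 1, \<lambda>x. \<Gamma> x 2 2 2, \<lambda>x. \<Phi> x $ 1 $ 1, \<lambda>x. \<Phi> x $ 1 $ 2, \<lambda>x. \<Phi> x $ 2 $ 2] ! n else \<alpha>)"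
    by (auto simp: fields_def fun_eq_iff numeral_eq_Suc less_Suc_eq)
  have "smooth_on U f" if "f \<in> set [\<alpha>, \<xi>, \<lambda>x. \<Gamma> x 1 1 1, \<lambda>x. \<Gamma> x 1 1 2, \<lambda>x. \<Gamma> x 1 2 1, \<lambda>x. \<Gamma> x 1 2 2,
      \<lambda>x. \<Gamma> x 2 2 1, \<lambda>x. \<Gamma> x 2 2 2, \<lambda>x. \<Phi> x $ 1 $ 1, \<lambda>x. \<Phi> x $ 1 $ 2, \<lambda>x. \<Phi> x $ 2 $ 2]" for f
    using that surface smooth \<Phi> by (auto simp: affine_surface_def smooth_sym_2tensor_def)
  then show ?thesis
    unfolding eq using nth_mem[of n] smooth(1) by (cases "n < 11") (simp_all del: list.set)
qed

lemma jval_Jet [simp]: "jval F p (Jet n a b) = pd a b (F n) (base_pt p)"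
  by (simp add: jval_def)

text \<open>The transfer principle: a formal description of \<open>f\<close> valid on all of
  \<open>S\<close>, up to the integer scaling \<open>c\<close>, yields both the differentiability of
  \<open>f\<close> and its derivatives.\<close>

lemma ev_pder:
  assumes "p \<in> S" "c \<noteq> 0" "\<And>z. z \<in> S \<Longrightarrow> ev z P = c * f z"
  shows "ev p (pder i P) = c * partial i f p"
    and "f differentiable at p"
proof -
  note P = peval_differentiable_partial[OF open_U smooth_F assms(1), where P = P and i = i]
  have f: "f z = inverse c * ev z P" if "z \<in> S" for z
    using assms(2,3) that by simp
  have "partial i f p = partial i (\<lambda>z. inverse c * ev z P) p"
    by (rule partial_cong[OF open_S assms(1) f])
  also have "\<dots> = inverse c * ev p (pder i P)"
    using P partial_cmult[of "\<lambda>z. ev z P" p i "inverse c"] by simp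
  finally show "ev p (pder i P) = c * partial i f p"
    using assms(2) by simp
  have "(\<lambda>z. inverse c * ev z P) differentiable at p"
    using P by simp
  then obtain D where D: "((\<lambda>z. inverse c * ev z P) has_derivative D) (at p)"
    unfolding differentiable_def by blast
  have "(f has_derivative D) (at p)"
    by (rule has_derivative_transform_within_open[OF D open_S assms(1)]) (simp add: f)
  then show "f differentiable at p"
    unfolding differentiable_def by blast
qed

lemma ev_G: "p \<in> S \<Longrightarrow> ev p (G i j) = g p $ i $ j"
proof -
  assume p: "p \<in> S"
  then have x: "base_pt p \<in> U" by (simp add: cotangent_bundle_def)
  \<comment> \<open>The table stores only the components with lower indices 11, 12 and 22.\<close>
  have sym: "\<Gamma> (base_pt p) 2 1 k = \<Gamma> (base_pt p) 1 2 k" "\<Phi> (base_pt p) $ 2 $ 1 = \<Phi> (base_pt p) $ 1 $ 2" for k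
    using surface \<Phi> x by (auto simp: affine_surface_def smooth_sym_2tensor_def)
  show ?thesis
    by (cases i rule: idx_cases; cases j rule: idx_cases)
      (simp_all add: entry2_def entry_simps metric_tab_def riemannian_extension_def ext_xx_def bspec[OF T x]
        vector_2 sum_2 sym pxx_def ptau_def fields_def pd_def jval_def fiber_pt_def
        algebra_simps power2_eq_square)
qed

lemma metric_inv_g:
  "metric_inv g p (Inl i) (Inl j) = 0"
  "metric_inv g p (Inl i) (Inr j) = (if i = j then 1 else 0)"
  "metric_inv g p (Inr i) (Inl j) = (if i = j then 1 else 0)"
  "metric_inv g p (Inr i) (Inr j) = - g p $ Inl i $ Inl j"
proof -
  define h :: "real^idx^idx" where "h = (\<chi> a b. case (a, b) of
       (Inl i, Inl j) \<Rightarrow> 0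
     | (Inl i, Inr j) \<Rightarrow> if i = j then 1 else 0
     | (Inr i, Inl j) \<Rightarrow> if i = j then 1 else 0
     | (Inr i, Inr j) \<Rightarrow> - g p $ Inl i $ Inl j)"
  have "(g p ** h) $ a $ b = mat 1 $ a $ b" for a b
    by (cases a rule: idx_cases; cases b rule: idx_cases)
      (simp_all add: matrix_matrix_mult_def mat_def h_def riemannian_extension_def sum_UNIV_sum_type sum_2)
  then have gh: "g p ** h = mat 1"
    by (simp add: vec_eq_iff)
  have "matrix_inv (g p) ** g p = mat 1"
    using someI_ex[OF invertible_riemannian_extension[unfolded invertible_def]] by (simp add: matrix_inv_def)
  then have "matrix_inv (g p) = h"
    using gh by (metis matrix_mul_assoc matrix_mul_lid matrix_mul_rid)
  then show
    "metric_inv g p (Inl i) (Inl j) = 0"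
    "metric_inv g p (Inl i) (Inr j) = (if i = j then 1 else 0)"
    "metric_inv g p (Inr i) (Inl j) = (if i = j then 1 else 0)"
    "metric_inv g p (Inr i) (Inr j) = - g p $ Inl i $ Inl j"
    by (simp_all add: metric_inv_def h_def)
qed

lemma g_simps:
  "g p $ Inl i $ Inr j = (if i = j then 1 else 0)"
  "g p $ Inr i $ Inl j = (if i = j then 1 else 0)"
  "g p $ Inr i $ Inr j = 0"
  by (simp_all add: riemannian_extension_def)

section \<open>The formal geometry evaluates to the geometry of \<open>g\<close>\<close>

lemma ev_praise:
  assumes "p \<in> S"
  shows "ev p (praise G P k) = (\<Sum>l\<in>UNIV. metric_inv g p k l * ev p (P l))"
  using assms by (cases k rule: idx_cases)
    (simp_all add: sum_UNIV_sum_type sum_2 metric_inv_g ev_G)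

lemma ev_plower:
  assumes "p \<in> S"
  shows "ev p (plower G P k) = (\<Sum>l\<in>UNIV. ev p (P l) * g p $ l $ k)"
  using assms by (cases k rule: idx_cases)
    (simp_all add: sum_UNIV_sum_type sum_2 g_simps ev_G)

lemma ev_pcontr:
  assumes "p \<in> S"
  shows "ev p (pcontr G P) = (\<Sum>k\<in>UNIV. \<Sum>l\<in>UNIV. metric_inv g p k l * ev p (P k l))"
  using assms by (simp add: pcontr_def sum_UNIV_sum_type sum_2 metric_inv_g ev_G)

lemma ev_dG: "p \<in> S \<Longrightarrow> ev p (pdG G i j k) = partial i (\<lambda>z. g z $ j $ k) p"
  unfolding pdG_def using ev_pder(1)[of p 1 "G j k" "\<lambda>z. g z $ j $ k" i] by (simp add: ev_G)

lemma ev_L: "p \<in> S \<Longrightarrow> ev p (L i j k) = 2 * LC p i j k"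
  by (simp add: pLC_def ev_praise levi_civita_def ev_dG)

lemma ev_dL: "p \<in> S \<Longrightarrow> ev p (pder i (L j k l)) = 2 * partial i (\<lambda>z. LC z j k l) p"
  by (rule ev_pder(1)) (simp_all add: ev_L)

lemma ev_R: "p \<in> S \<Longrightarrow> ev p (R i j k l) = 4 * curvature_op LC p i j k l"
  by (simp add: pRop_def ev_L ev_dL curvature_op_def sum_distrib_left algebra_simps)

lemma ev_r: "p \<in> S \<Longrightarrow> ev p (r j k) = 4 * ricci g p j k"
  by (simp add: pRic_def ev_R ricci_def sum_distrib_left)

lemma ev_scal: "p \<in> S \<Longrightarrow> ev p (pcontr G r) = 4 * scalar_curvature g p"
  by (simp add: ev_pcontr ev_r scalar_curvature_def sum_distrib_left mult_ac)

lemma scalar_curvature_zero: "p \<in> S \<Longrightarrow> scalar_curvature g p = 0"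
  and bach_defects_zero: "entry2 (bach_defects B) i j = Cst 0"
proof -
  have "pcontr G r = Cst 0 \<and> check_tab (bach_defects B)"
    using bach_check
    by (simp add: bach_check_def with_derivatives_def with_LC_def with_curvature_def with_ricci_def
        with_weyl_def with_div_def check_bach_def)
  then show "p \<in> S \<Longrightarrow> scalar_curvature g p = 0" "entry2 (bach_defects B) i j = Cst 0"
    using ev_scal[of p] by (simp_all add: check_tab_entry)
qed

text \<open>In dimension four the Ricci part of the Weyl tensor has the factor 1/2, which turns 8
  into the 4 carried by \<open>r\<close>; the scalar curvature part vanishes.\<close>

lemma ev_W: "p \<in> S \<Longrightarrow> ev p (W i j k l) = 8 * weyl g p i j k l"
  by (simp add: pWeyl_def ev_plower ev_R ev_r ev_G weyl_def scalar_curvature_zero riemann_def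
      sum_distrib_left algebra_simps)

lemma ev_dW: "p \<in> S \<Longrightarrow> ev p (pder m (W i j k l)) = 8 * partial m (\<lambda>z. weyl g z i j k l) p"
  by (rule ev_pder(1)) (simp_all add: ev_W)

lemma ev_nabla_W:
  "p \<in> S \<Longrightarrow> ev p (pnabla4 L W m i j k l) = 16 * nabla LC (weyl_tensor g) p [m, i, j, k, l]"
  by (simp add: pnabla4_def ev_dW ev_L ev_W sum_distrib_left sum.distrib algebra_simps)

text \<open>The contracted slots are placed first and last to fit
  \<open>nabla_contraction\<close>.\<close>

definition div_weyl :: "idx tensor" where
  "div_weyl z is = (\<Sum>l\<in>UNIV. \<Sum>b\<in>UNIV. metric_inv g z l b * nabla LC (weyl_tensor g) z (b # is @ [l]))"

lemma ev_C: "p \<in> S \<Longrightarrow> ev p (C k i j) = 16 * div_weyl p [k, i, j]"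
  by (simp add: pDiv_def ev_pcontr ev_nabla_W div_weyl_def sum_distrib_left mult_ac del: nabla.simps)

lemma ev_dC: "p \<in> S \<Longrightarrow> ev p (pder m (C k i j)) = 16 * partial m (\<lambda>z. div_weyl z [k, i, j]) p"
  by (rule ev_pder(1)) (simp_all add: ev_C)

lemma ev_nabla_C: "p \<in> S \<Longrightarrow> ev p (pnabla3 L C a k i j) = 32 * nabla LC div_weyl p [a, k, i, j]"
  by (simp add: pnabla3_def ev_dC ev_L ev_C sum_distrib_left sum.distrib algebra_simps)

lemma ev_pinv: "p \<in> S \<Longrightarrow> ev p (pinv G i j) = metric_inv g p i j"
  by (cases "(G, i, j)" rule: pinv.cases) (simp_all add: metric_inv_g ev_G)

lemma metric_inv_parallel:
  assumes "p \<in> S"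
  shows "partial a (\<lambda>z. metric_inv g z i j) p =
    - (\<Sum>m\<in>UNIV. LC p a m i * metric_inv g p m j + LC p a m j * metric_inv g p i m)"
proof -
  have "check_tab (entry (tab3 (pPar (pinv G) L)) a)"
    using parallel_check
    by (simp add: parallel_check_def parallel_with_derivatives_def parallel_with_LC_def
        check_parallel_def pred_quad_entry)
  then have "pPar (pinv G) L a i j = Cst 0"
    unfolding check_tab_entry using entry_tab3[of "pPar (pinv G) L"] by (metis entry2_def entry3_def)
  then have "ev p (pPar (pinv G) L a i j) = 0"
    by simp
  moreover have "ev p (pder a (pinv G i j)) = 1 * partial a (\<lambda>z. metric_inv g z i j) p"
    using assms by (intro ev_pder(1)) (simp_all add: ev_pinv)
  ultimately have "2 * partial a (\<lambda>z. metric_inv g z i j) p +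
      2 * (\<Sum>m\<in>UNIV. LC p a m i * metric_inv g p m j + LC p a m j * metric_inv g p i m) = 0"
    using assms by (simp add: pPar_def ev_L ev_pinv sum_distrib_left mult_ac distrib_left)
  then show ?thesis by simp
qed

text \<open>As the inverse metric is parallel, the inner contraction may precede the outer
  derivative. Only a rank three tensor then remains to be differentiated.\<close>

lemma div_div_weyl:
  assumes "p \<in> S"
  shows "(\<Sum>l\<in>UNIV. \<Sum>b\<in>UNIV. metric_inv g p l b * nabla LC (nabla LC (weyl_tensor g)) p [a, b, k, i, j, l]) =
    nabla LC div_weyl p [a, k, i, j]"
proof -
  have "(\<lambda>z. metric_inv g z l b) differentiable at p" for l b
    using assms by (intro ev_pder(2)[of p 1 "pinv G l b"]) (simp_all add: ev_pinv)
  moreover have "(\<lambda>z. nabla LC (weyl_tensor g) z (b # [k, i, j] @ [l])) differentiable at p" for l b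
    using assms by (intro ev_pder(2)[of p 16 "pnabla4 L W b k i j l"]) (simp_all add: ev_nabla_W del: nabla.simps)
  ultimately show ?thesis
    using nabla_contraction[where N = "\<lambda>l b z. metric_inv g z l b" and A = "nabla LC (weyl_tensor g)"
        and \<Gamma> = LC and p = p and a = a and js = "[k, i, j]"] metric_inv_parallel[OF assms]
    unfolding div_weyl_def[abs_def] by simp
qed

lemma ev_B:
  assumes "p \<in> S"
  shows "ev p (B i j) = 64 * bach g p i j"
proof -
  let ?N = "metric_inv g p" and ?D = "\<lambda>a b k l. nabla LC (nabla LC (weyl_tensor g)) p [a, b, k, i, j, l]"
  have "(\<Sum>k\<in>UNIV. \<Sum>l\<in>UNIV. \<Sum>a\<in>UNIV. \<Sum>b\<in>UNIV. ?N k a * ?N l b * ?D a b k l) =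
      (\<Sum>k\<in>UNIV. \<Sum>a\<in>UNIV. \<Sum>l\<in>UNIV. \<Sum>b\<in>UNIV. ?N k a * ?N l b * ?D a b k l)"
    by (intro sum.cong refl sum.swap)
  also have "\<dots> = (\<Sum>k\<in>UNIV. \<Sum>a\<in>UNIV. ?N k a * nabla LC div_weyl p [a, k, i, j])"
    by (simp only: div_div_weyl[OF assms, symmetric] sum_distrib_left mult.assoc)
  finally have 1: "(\<Sum>k\<in>UNIV. \<Sum>l\<in>UNIV. \<Sum>a\<in>UNIV. \<Sum>b\<in>UNIV. ?N k a * ?N l b * ?D a b k l) =
      (\<Sum>k\<in>UNIV. \<Sum>a\<in>UNIV. ?N k a * nabla LC div_weyl p [a, k, i, j])" .
  have "(\<Sum>k\<in>UNIV. \<Sum>l\<in>UNIV. \<Sum>a\<in>UNIV. \<Sum>b\<in>UNIV. ?N k a * ?N l b * ricci g p a b * weyl g p k i j l) =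
      (\<Sum>k\<in>UNIV. \<Sum>a\<in>UNIV. \<Sum>l\<in>UNIV. \<Sum>b\<in>UNIV. ?N k a * ?N l b * ricci g p a b * weyl g p k i j l)"
    by (intro sum.cong refl sum.swap)
  then have 2: "(\<Sum>k\<in>UNIV. \<Sum>l\<in>UNIV. \<Sum>a\<in>UNIV. \<Sum>b\<in>UNIV. ?N k a * ?N l b * ricci g p a b * weyl g p k i j l) =
      (\<Sum>k\<in>UNIV. \<Sum>a\<in>UNIV. ?N k a * (\<Sum>l\<in>UNIV. \<Sum>b\<in>UNIV. ?N l b * (ricci g p a b * weyl g p k i j l)))"
    by (simp only: sum_distrib_left mult.assoc)
  \<comment> \<open>The scalings match: 2 * 32 = 64 for the divergence term, and 4 * 8 = 64 / 2 for
    the Ricci term.\<close>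
  show ?thesis
    using assms unfolding bach_def 1 2
    by (simp add: pBach_def ev_pcontr ev_nabla_C ev_r ev_W sum_distrib_left mult_ac del: nabla.simps)
qed

section \<open>The Bach tensor in terms of \<open>P1\<close> and \<open>P2\<close>\<close>

lemma F_eq:
  "F 0 = \<alpha>" "F (Suc 0) = \<xi>" "F 2 = (\<lambda>x. \<Gamma> x 1 1 1)" "F 3 = (\<lambda>x. \<Gamma> x 1 1 2)" "F 4 = (\<lambda>x. \<Gamma> x 1 2 1)"
  "F 5 = (\<lambda>x. \<Gamma> x 1 2 2)" "F 6 = (\<lambda>x. \<Gamma> x 2 2 1)" "F 7 = (\<lambda>x. \<Gamma> x 2 2 2)"
  by (simp_all add: fields_def fun_eq_iff)

lemma ev_P1: "ev p pP1 = P1 \<Gamma> \<xi> (base_pt p)"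
  by (simp add: pP1_def P1_def F_eq pd_def) (simp add: algebra_simps power2_eq_square power3_eq_cube)

lemma ev_P2: "ev p pP2 = P2 \<Gamma> \<xi> \<alpha> (base_pt p)"
proof -
  have pd0: "pd 0 0 f = f" for f by (simp add: pd_def)
  show ?thesis
    unfolding pP2_def P2_def Let_def
    by (simp only: peval_plus peval_minus peval_times peval_pvar jval_Jet peval.simps F_eq One_nat_def pd0)
      (simp add: power2_eq_square power3_eq_cube power4_eq_xxxx mult_ac)
qed

text \<open>By the symmetry of the base block, the left side is the Bach tensor evaluated twice on
  \<open>\<partial>_1 - \<xi> \<partial>_2\<close>, whose base direction lies in the kernel of
  \<open>T\<close>. Where \<alpha> is nonzero, its vanishing forces \<open>P1\<close> to
  vanish.\<close>

lemma bach_identity_11: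
  assumes "p \<in> S"
  defines "x \<equiv> base_pt p"
  shows "bach g p (Inl 1) (Inl 1) - 2 * \<xi> x * bach g p (Inl 1) (Inl 2) + (\<xi> x)\<^sup>2 * bach g p (Inl 2) (Inl 2) =
    - 4 * (\<alpha> x)\<^sup>2 * (P1 \<Gamma> \<xi> x)\<^sup>2"
  using arg_cong[OF bach_defects_zero[of "Inl 1" "Inl 1"], of "ev p"] assms(1)
  by (simp add: bach_defects_def entry2_def entry_simps ev_B ev_P1 F_eq pd_def x_def power2_eq_square)

lemma bach_identities:
  assumes "p \<in> S"
  shows "64 * (bach g p (Inl 1) (Inl 2) - \<xi> (base_pt p) * bach g p (Inl 2) (Inl 2)) = ev p pE12"
    and "64 * bach g p (Inl 2) (Inl 2) = ev p pE22 - 256 * P2 \<Gamma> \<xi> \<alpha> (base_pt p)"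
    and "bach g p (Inl 2) (Inl 1) = bach g p (Inl 1) (Inl 2)"
    and "bach g p (Inl i) (Inr k) = 0" "bach g p (Inr k) j = 0"
proof -
  have D: "ev p (entry2 (bach_defects B) i j) = 0" for i j
    by (simp add: bach_defects_zero)
  note simps = bach_defects_def entry2_def entry_simps ev_B[OF assms] ev_P2 F_eq pd_def
  show "64 * (bach g p (Inl 1) (Inl 2) - \<xi> (base_pt p) * bach g p (Inl 2) (Inl 2)) = ev p pE12"
    using D[of "Inl 1" "Inl 2"] by (simp add: simps algebra_simps)
  show "64 * bach g p (Inl 2) (Inl 2) = ev p pE22 - 256 * P2 \<Gamma> \<xi> \<alpha> (base_pt p)"
    using D[of "Inl 2" "Inl 2"] by (simp add: simps algebra_simps)
  show "bach g p (Inl 2) (Inl 1) = bach g p (Inl 1) (Inl 2)"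
    using D[of "Inl 2" "Inl 1"] by (simp add: simps)
  show "bach g p (Inl i) (Inr k) = 0"
    using D[of "Inl i" "Inr k"] exhaust_2[of i] exhaust_2[of k] by (auto simp: simps)
  show "bach g p (Inr k) j = 0"
    using D[of "Inr k" j] exhaust_2[of k] by (auto simp: simps)
qed

text \<open>Since \<open>P1\<close> vanishes on the whole open set, so do its first derivatives, and
  both remainders are linear in these.\<close>

lemma ev_E_zero:
  assumes "\<forall>x\<in>U. P1 \<Gamma> \<xi> x = 0" "p \<in> S"
  shows "ev p pE12 = 0" "ev p pE22 = 0"
proof -
  have P1: "ev z pP1 = 0" if "z \<in> S" for z
    using assms(1) that by (simp add: ev_P1 cotangent_bundle_def)
  then have "ev p (pder i pP1) = 0" for i
    using ev_pder(1)[OF assms(2), of 1 pP1 "\<lambda>_. 0"] by (simp add: partial_const)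
  with P1[OF assms(2)] show "ev p pE12 = 0" "ev p pE22 = 0"
    by (simp_all add: pE12_def pE22_def)
qed

lemma bach_flat_iff:
  assumes nonzero: "\<forall>x\<in>U. \<alpha> x \<noteq> 0"
  shows "bach_flat_on S g \<longleftrightarrow> (\<forall>x\<in>U. P1 \<Gamma> \<xi> x = 0) \<and> (\<forall>x\<in>U. P2 \<Gamma> \<xi> \<alpha> x = 0)"
proof safe
  assume flat: "bach_flat_on S g"
  \<comment> \<open>The zero covector serves as the point over \<open>x\<close>.\<close>
  have lift: "\<exists>p\<in>S. base_pt p = x" if "x \<in> U" for x
    using that by (intro bexI[of _ "\<chi> i. case i of Inl k \<Rightarrow> x $ k | Inr _ \<Rightarrow> 0"])
      (simp_all add: base_pt_def cotangent_bundle_def)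
  show P1: "P1 \<Gamma> \<xi> x = 0" if x: "x \<in> U" for x
  proof -
    obtain p where "p \<in> S" "base_pt p = x"
      using lift[OF x] by blast
    then show ?thesis
      using bach_identity_11[of p] flat nonzero x by (simp add: bach_flat_on_def)
  qed
  show "P2 \<Gamma> \<xi> \<alpha> x = 0" if x: "x \<in> U" for x
  proof -
    obtain p where "p \<in> S" "base_pt p = x"
      using lift[OF x] by blast
    then show ?thesis
      using bach_identities(2)[of p] ev_E_zero(2)[of p] flat P1 by (simp add: bach_flat_on_def)
  qed
next
  assume P1: "\<forall>x\<in>U. P1 \<Gamma> \<xi> x = 0" and P2: "\<forall>x\<in>U. P2 \<Gamma> \<xi> \<alpha> x = 0"
  have "bach g p i j = 0" if p: "p \<in> S" for p i j
  proof -
    have x: "base_pt p \<in> U"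
      using p by (simp add: cotangent_bundle_def)
    \<comment> \<open>The identities are triangular: the 22 component comes first, then 12, then
      11.\<close>
    have "bach g p (Inl 2) (Inl 2) = 0"
      using bach_identities(2)[OF p] ev_E_zero(2)[OF P1 p] P2 x by simp
    moreover from this have "bach g p (Inl 1) (Inl 2) = 0"
      using bach_identities(1)[OF p] ev_E_zero(1)[OF P1 p] by simp
    moreover from calculation have "bach g p (Inl 1) (Inl 1) = 0"
      using bach_identity_11[OF p] P1 x by simp
    ultimately show ?thesis
      using bach_identities(3-5)[OF p] by (cases i rule: idx_cases; cases j rule: idx_cases) simp_all
  qed
  then show "bach_flat_on S g"
    by (simp add: bach_flat_on_def)
qed

end

theorem theorem1p4:
  fixes U :: "(real^2) set"
    and \<Gamma> :: "2 connection"
    and T \<Phi> :: "real^2 \<Rightarrow> real^2^2"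
    and \<alpha> \<xi> :: "real^2 \<Rightarrow> real"
  assumes surface: "affine_surface U \<Gamma>"
    and smooth: "smooth_on U \<alpha>" "smooth_on U \<xi>"
    and nonzero: "\<forall>x\<in>U. \<alpha> x \<noteq> 0"
    and T: "\<forall>x\<in>U. T x = \<alpha> x *\<^sub>R vector [vector [\<xi> x, 1], vector [- (\<xi> x)\<^sup>2, - \<xi> x]]"
    and \<Phi>: "smooth_sym_2tensor U \<Phi>"
  shows "bach_flat_on (cotangent_bundle U) (riemannian_extension T \<Gamma> \<Phi>) \<longleftrightarrow>
    (\<forall>x\<in>U. P1 \<Gamma> \<xi> x = 0) \<and> (\<forall>x\<in>U. P2 \<Gamma> \<xi> \<alpha> x = 0)"
proof -
  interpret nilpotent_extension U \<Gamma> T \<Phi> \<alpha> \<xi>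
    using surface smooth T \<Phi> by unfold_locales
  show ?thesis
    by (rule bach_flat_iff[OF nonzero])
qed

end
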